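(* For every integer $n \geq 2$, every connected bisplit graph $G$ on $n$ vertices has the de Bruijn-Erd\H{o}s property; that is, the metric space $(V(G), d_G)$ has a universal line or has at least $n$ distinct lines.
   Context: A connected graph $G$ is bisplit if its vertex set can be partitioned into three stable (independent) sets $X$, $Y$, $Z$ (some possibly empty) such that every vertex of $Y$ is adjacent to every vertex of $Z$. The graph $G$ is viewed as a metric space with $d_G$ the usual shortest-path distance. In a metric space $(V,\rho)$, an element $b$ is between $a$ and $c$ if $\rho(a,b)+\rho(b,c)=\rho(a,c)$; three elements are collinear if one of them is between the other two. For distinct $a,b\in V$, the line generated by $a$ and $b$ is the set consisting of $a$, $b$, and all elements $c$ such that $a,b,c$ are collinear. A line is universal if it equals the whole ground set $V$. A graph on $n$ vertices has the de Bruijn-Erd\H{o}s property if its metric space has a universal line or at least $n$ distinct lines. *)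

theory Defs
  imports Main
begin

definition simple_graph :: "'a set \<Rightarrow> ('a \<Rightarrow> 'a \<Rightarrow> bool) \<Rightarrow> bool" where
  "simple_graph V E \<longleftrightarrow> finite V \<and> (\<forall>x y. E x y \<longrightarrow> E y x) \<and> (\<forall>x. \<not> E x x)
     \<and> (\<forall>x y. E x y \<longrightarrow> x \<in> V \<and> y \<in> V)"

fun walk :: "('a \<Rightarrow> 'a \<Rightarrow> bool) \<Rightarrow> 'a list \<Rightarrow> bool" where
  "walk E [] = False"
| "walk E [x] = True"
| "walk E (x # y # xs) = (E x y \<and> walk E (y # xs))"

definition walk_between :: "('a \<Rightarrow> 'a \<Rightarrow> bool) \<Rightarrow> 'a \<Rightarrow> 'a \<Rightarrow> 'a list \<Rightarrow> bool" where
  "walk_between E x y p \<longleftrightarrow> walk E p \<and> hd p = x \<and> last p = y"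

definition connected_graph :: "'a set \<Rightarrow> ('a \<Rightarrow> 'a \<Rightarrow> bool) \<Rightarrow> bool" where
  "connected_graph V E \<longleftrightarrow> V \<noteq> {} \<and> (\<forall>x\<in>V. \<forall>y\<in>V. \<exists>p. walk_between E x y p)"

definition gdist :: "('a \<Rightarrow> 'a \<Rightarrow> bool) \<Rightarrow> 'a \<Rightarrow> 'a \<Rightarrow> nat" where
  "gdist E x y = (LEAST k. \<exists>p. walk_between E x y p \<and> length p = Suc k)"

definition stable :: "('a \<Rightarrow> 'a \<Rightarrow> bool) \<Rightarrow> 'a set \<Rightarrow> bool" where
  "stable E S \<longleftrightarrow> (\<forall>x\<in>S. \<forall>y\<in>S. \<not> E x y)"

definition bisplit :: "'a set \<Rightarrow> ('a \<Rightarrow> 'a \<Rightarrow> bool) \<Rightarrow> bool" where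
  "bisplit V E \<longleftrightarrow> (\<exists>X Y Z. X \<union> Y \<union> Z = V \<and> X \<inter> Y = {} \<and> X \<inter> Z = {} \<and> Y \<inter> Z = {}
      \<and> stable E X \<and> stable E Y \<and> stable E Z \<and> (\<forall>y\<in>Y. \<forall>z\<in>Z. E y z))"

definition between :: "('a \<Rightarrow> 'a \<Rightarrow> nat) \<Rightarrow> 'a \<Rightarrow> 'a \<Rightarrow> 'a \<Rightarrow> bool" where
  "between \<rho> a b c \<longleftrightarrow> \<rho> a b + \<rho> b c = \<rho> a c"

definition collinear3 :: "('a \<Rightarrow> 'a \<Rightarrow> nat) \<Rightarrow> 'a \<Rightarrow> 'a \<Rightarrow> 'a \<Rightarrow> bool" where
  "collinear3 \<rho> a b c \<longleftrightarrow> between \<rho> b a c \<or> between \<rho> a b c \<or> between \<rho> a c b"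

definition line :: "'a set \<Rightarrow> ('a \<Rightarrow> 'a \<Rightarrow> nat) \<Rightarrow> 'a \<Rightarrow> 'a \<Rightarrow> 'a set" where
  "line V \<rho> a b = {a, b} \<union> {c\<in>V. collinear3 \<rho> a b c}"

definition lines :: "'a set \<Rightarrow> ('a \<Rightarrow> 'a \<Rightarrow> nat) \<Rightarrow> 'a set set" where
  "lines V \<rho> = {line V \<rho> a b | a b. a \<in> V \<and> b \<in> V \<and> a \<noteq> b}"

definition has_dBE_property :: "'a set \<Rightarrow> ('a \<Rightarrow> 'a \<Rightarrow> nat) \<Rightarrow> bool" where
  "has_dBE_property V \<rho> \<longleftrightarrow> (\<exists>L\<in>lines V \<rho>. L = V) \<or> card (lines V \<rho>) \<ge> card V"

end

theory Submission
  imports Complex_Main Defs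
begin

text \<open>
  Choose the partition with \<open>Y \<union> Z\<close> as large as possible. If \<open>Y\<close> or \<open>Z\<close> is empty, the graph is
  bipartite and every edge generates a universal line by parity. Otherwise \<open>X\<close> splits into \<open>A\<close> (no
  neighbour in \<open>Z\<close>), \<open>B\<close> (no neighbour in \<open>Y\<close>) and \<open>C\<close> (neighbours in both), all distances are at
  most 4, and each line can be computed explicitly; assume that none is universal.

  If \<open>A \<noteq> {}\<close>, then \<open>|Y| \<ge> 3\<close>, by maximality and because a pendant edge
  generates a universal line. Pairs in \<open>Y\<close> and pairs in \<open>Z\<close> give binomially many lines,
  the lines \<open>ac\<close> for a fixed \<open>a \<in> A\<close> give \<open>|C|\<close> more, and for fixed \<open>y\<close>, \<open>z\<close> the lines \<open>ay\<close> with
  \<open>a\<close> not adjacent to \<open>y\<close>, together with \<open>az\<close> with \<open>a\<close> adjacent to \<open>y\<close>, give \<open>|A|\<close> more,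
  up to one coincidence that the surplus of pairs in \<open>Y\<close> makes up for; likewise for \<open>B\<close>. If \<open>|Y| = 3\<close> and \<open>|Z| \<le> 2\<close>,
  one line generated by a pair in \<open>C\<close> is needed as well.

  If \<open>A = B = {}\<close>, every twin class of \<open>C\<close> contributes as many lines as it has elements: an edge line
  of a representative \<open>r\<close>, which determines the neighbourhood of \<open>r\<close>, and the lines \<open>rc\<close>
  for the other twins \<open>c\<close>. These differ from all lines generated by pairs in \<open>Y \<union> Z\<close>, of which there are
  at least \<open>|Y| + |Z|\<close> except for \<open>|Y| = |Z| = 1\<close> and one configuration with \<open>|Y| = |Z| = 2\<close>,
  where a further line is found.
\<close>

subsection \<open>Short distances\<close>

text \<open>A walk is a list of vertices, so \<open>Suc k\<close> entries mean \<open>k\<close>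
  steps; distances thereby become least exponents of relation powers.\<close>

lemma walk_iff_relpowp:
  "(\<exists>p. walk_between E x y p \<and> length p = Suc k) \<longleftrightarrow> (E ^^ k) x y"
proof (induction k arbitrary: x)
  case 0
  show ?case
    by (auto simp: walk_between_def length_Suc_conv intro: exI[of _ "[y]"])
next
  case (Suc k)
  show ?case
  proof
    assume "\<exists>p. walk_between E x y p \<and> length p = Suc (Suc k)"
    then obtain w q where "walk_between E x y (x # w # q)" "length q = k"
      by (auto simp: walk_between_def length_Suc_conv)
    then have "E x w" "walk_between E w y (w # q)" "length (w # q) = Suc k"
      by (auto simp: walk_between_def)
    then show "(E ^^ Suc k) x y"
      using Suc[of w] relpowp_Suc_I2[of E x w k y] by blast
  next
    assume "(E ^^ Suc k) x y"
    then obtain w where w: "E x w" "(E ^^ k) w y"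
      using relpowp_Suc_D2 by metis
    then obtain p where p: "walk_between E w y p" "length p = Suc k"
      using Suc by blast
    then obtain q where "p = w # q"
      by (cases p) (auto simp: walk_between_def)
    then show "\<exists>p. walk_between E x y p \<and> length p = Suc (Suc k)"
      using p w by (intro exI[of _ "x # p"]) (auto simp: walk_between_def)
  qed
qed

lemma gdist_eq_Least: "gdist E x y = (LEAST k. (E ^^ k) x y)"
  unfolding gdist_def walk_iff_relpowp ..

lemma gdist_eqI:
  "(E ^^ k) x y \<Longrightarrow> (\<And>j. (E ^^ j) x y \<Longrightarrow> k \<le> j) \<Longrightarrow> gdist E x y = k"
  unfolding gdist_eq_Least by (rule Least_equality)

lemma relpowp_sym:
  assumes "symp E" shows "(E ^^ k) x y \<Longrightarrow> (E ^^ k) y x"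
proof (induction k arbitrary: y)
  case (Suc k)
  then obtain w where "(E ^^ k) x w" "E w y" by auto
  then show ?case using Suc.IH assms relpowp_Suc_I2[of E y w k x] by (auto dest: sympD)
qed simp

lemma gdist_sym: "symp E \<Longrightarrow> gdist E x y = gdist E y x"
  unfolding gdist_eq_Least by (metis relpowp_sym)

lemma gdist_1: "E x y \<Longrightarrow> x \<noteq> y \<Longrightarrow> gdist E x y = 1"
proof (rule gdist_eqI)
  show "x \<noteq> y \<Longrightarrow> (E ^^ j) x y \<Longrightarrow> 1 \<le> j" for j by (cases j) auto
qed (auto simp: relcompp_apply)

lemma ge_2I: "(E ^^ j) x y \<Longrightarrow> x \<noteq> y \<Longrightarrow> \<not> E x y \<Longrightarrow> 2 \<le> j"
  by (cases j; cases "j - 1") auto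

lemma ge_3I:
  assumes "(E ^^ j) x y" "x \<noteq> y" "\<not> E x y" "\<And>v. E x v \<Longrightarrow> \<not> E v y"
  shows "3 \<le> j"
proof -
  have "j \<noteq> 2" using assms(1,4) by (auto simp: numeral_2_eq_2)
  then show ?thesis using ge_2I[OF assms(1-3)] by auto
qed

lemma ge_4I:
  assumes "(E ^^ j) x y" "x \<noteq> y" "\<not> E x y" "\<And>v. E x v \<Longrightarrow> \<not> E v y"
    "\<And>v w. E x v \<Longrightarrow> E v w \<Longrightarrow> \<not> E w y"
  shows "4 \<le> j"
proof -
  have "j \<noteq> 3" using assms(1,5) by (auto simp: numeral_3_eq_3)
  then show ?thesis using ge_3I[OF assms(1-4)] by auto
qed

lemma gdist_2:
  assumes "x \<noteq> y" "\<not> E x y" "E x v" "E v y"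
  shows "gdist E x y = 2"
proof (rule gdist_eqI)
  show "(E ^^ 2) x y" using assms(3,4) by (auto simp: numeral_2_eq_2)
qed (use ge_2I assms(1,2) in metis)

lemma gdist_3:
  assumes "x \<noteq> y" "\<not> E x y" "\<And>v. E x v \<Longrightarrow> \<not> E v y" "E x v" "E v w" "E w y"
  shows "gdist E x y = 3"
proof (rule gdist_eqI)
  show "(E ^^ 3) x y" using assms(4-6) by (auto simp: numeral_3_eq_3)
qed (use ge_3I assms(1-3) in metis)

lemma gdist_4:
  assumes "x \<noteq> y" "\<not> E x y" "\<And>v. E x v \<Longrightarrow> \<not> E v y"
    "\<And>v w. E x v \<Longrightarrow> E v w \<Longrightarrow> \<not> E w y" "E x v" "E v w" "E w u" "E u y"
  shows "gdist E x y = 4"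
proof (rule gdist_eqI)
  have "(E ^^ Suc (Suc (Suc (Suc 0)))) x y" using assms(5-8) by auto
  then show "(E ^^ 4) x y" by (simp add: numeral_eq_Suc)
qed (use ge_4I assms(1-4) in metis)

subsection \<open>Bisplit graphs\<close>

text \<open>The avoided class is a parameter, so exchanging \<open>Y\<close> and \<open>Z\<close>
  turns \<open>A\<close> into \<open>B\<close> by definition.\<close>

definition avoiding :: "('a \<Rightarrow> 'a \<Rightarrow> bool) \<Rightarrow> 'a set \<Rightarrow> 'a set \<Rightarrow> 'a set" where
  "avoiding E X W = {x \<in> X. \<forall>w\<in>W. \<not> E x w}"

definition mixed :: "('a \<Rightarrow> 'a \<Rightarrow> bool) \<Rightarrow> 'a set \<Rightarrow> 'a set \<Rightarrow> 'a set \<Rightarrow> 'a set" where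
  "mixed E X Y Z = {x \<in> X. (\<exists>y\<in>Y. E x y) \<and> (\<exists>z\<in>Z. E x z)}"

text \<open>For distinct vertices of the stable set \<open>X\<close> this says that their distance
  is 2.\<close>

definition meets :: "('a \<Rightarrow> 'a \<Rightarrow> bool) \<Rightarrow> 'a \<Rightarrow> 'a \<Rightarrow> bool" where
  "meets E x x' \<longleftrightarrow> (\<exists>v. E x v \<and> E x' v)"

lemma mixed_commute: "mixed E X Z Y = mixed E X Y Z"
  by (auto simp: mixed_def)

lemma meets_commute: "meets E x x' = meets E x' x"
  by (auto simp: meets_def)

text \<open>Connectedness is encoded by \<open>nonempty\<close>, \<open>complete\<close> and
  \<open>has_nbr\<close>: \<open>Y\<close> and \<open>Z\<close> are completely joined, and every
  vertex of \<open>X\<close> is attached to them.\<close>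

locale bisplit_space =
  fixes E :: "'a \<Rightarrow> 'a \<Rightarrow> bool" and X Y Z V :: "'a set"
  assumes finV: "finite V"
    and V_eq: "V = X \<union> Y \<union> Z"
    and disj: "X \<inter> Y = {}" "X \<inter> Z = {}" "Y \<inter> Z = {}"
    and sym: "E x y \<Longrightarrow> E y x"
    and edge_V: "E x y \<Longrightarrow> x \<in> V"
    and stab: "stable E X" "stable E Y" "stable E Z"
    and complete: "y \<in> Y \<Longrightarrow> z \<in> Z \<Longrightarrow> E y z"
    and nonempty: "Y \<noteq> {}" "Z \<noteq> {}"
    and has_nbr: "x \<in> X \<Longrightarrow> \<exists>w\<in>Y \<union> Z. E x w"
begin

abbreviation "A \<equiv> avoiding E X Z"
abbreviation "B \<equiv> avoiding E X Y"
abbreviation "C \<equiv> mixed E X Y Z"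
abbreviation "d \<equiv> gdist E"
abbreviation "L \<equiv> line V (gdist E)"

lemma swap: "bisplit_space E X Z Y V"
proof
  show "V = X \<union> Z \<union> Y" using V_eq by auto
  show "Z \<inter> Y = {}" using disj by auto
  show "\<exists>w\<in>Z \<union> Y. E x w" if "x \<in> X" for x using has_nbr[OF that] by auto
qed (use finV disj edge_V stab nonempty in simp_all, (blast intro: sym complete)+)

lemma symp: "symp E" by (rule sympI) (rule sym)

lemma meets_iff: "meets E x x' \<longleftrightarrow> (\<exists>v. E x v \<and> E v x')"
  by (metis meets_def sym)

lemma d_commute: "d x y = d y x" by (rule gdist_sym[OF symp])

lemma L_commute: "L x y = L y x"
proof -
  have "collinear3 d x y w = collinear3 d y x w" for w
    using d_commute[of x y] d_commute[of x w] d_commute[of y w]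
    unfolding collinear3_def between_def by linarith
  then show ?thesis by (auto simp: line_def)
qed

lemma no_edge:
  "x \<in> X \<Longrightarrow> x' \<in> X \<Longrightarrow> \<not> E x x'" "y \<in> Y \<Longrightarrow> y' \<in> Y \<Longrightarrow> \<not> E y y'" "z \<in> Z \<Longrightarrow> z' \<in> Z \<Longrightarrow> \<not> E z z'"
  using stab by (auto simp: stable_def)

lemma X_eq: "X = A \<union> B \<union> C"
  by (auto simp: avoiding_def mixed_def)

lemma V_cases: "V = Y \<union> Z \<union> A \<union> B \<union> C"
  using V_eq X_eq by auto

lemma kinds_disjoint:
  "Y \<inter> Z = {}" "Y \<inter> A = {}" "Y \<inter> B = {}" "Y \<inter> C = {}" "Z \<inter> A = {}" "Z \<inter> B = {}" "Z \<inter> C = {}"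
  "A \<inter> B = {}" "A \<inter> C = {}" "B \<inter> C = {}"
  using disj has_nbr by (fastforce simp: avoiding_def mixed_def)+

lemma AX: "a \<in> A \<Longrightarrow> a \<in> X" and BX: "a \<in> B \<Longrightarrow> a \<in> X" and CX: "a \<in> C \<Longrightarrow> a \<in> X"
  by (auto simp: avoiding_def mixed_def)

lemma A_nbr: "a \<in> A \<Longrightarrow> \<exists>y\<in>Y. E a y"
  using has_nbr by (auto simp: avoiding_def)

lemma A_nbrD: "a \<in> A \<Longrightarrow> E a v \<Longrightarrow> v \<in> Y"
  using edge_V[OF sym, of a v] V_eq no_edge(1)[of a v] by (auto simp: avoiding_def)

lemma C_nbr: "c \<in> C \<Longrightarrow> \<exists>y\<in>Y. E c y" "c \<in> C \<Longrightarrow> \<exists>z\<in>Z. E c z"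
  by (auto simp: mixed_def)

lemma X_nbrD: "x \<in> X \<Longrightarrow> E x v \<Longrightarrow> v \<in> Y \<union> Z"
  using edge_V[OF sym, of x v] V_eq no_edge(1)[of x v] by auto

lemma Y_ne_Z: "y \<in> Y \<Longrightarrow> z \<in> Z \<Longrightarrow> y \<noteq> z" and X_ne_Y: "x \<in> X \<Longrightarrow> y \<in> Y \<Longrightarrow> x \<noteq> y"
  and X_ne_Z: "x \<in> X \<Longrightarrow> z \<in> Z \<Longrightarrow> x \<noteq> z"
  using disj by auto

section \<open>Distances between the five kinds of vertices\<close>

lemma d_refl: "d x x = 0" by (rule gdist_eqI) auto

lemma d_YZ: "y \<in> Y \<Longrightarrow> z \<in> Z \<Longrightarrow> d y z = 1"
  by (intro gdist_1 complete Y_ne_Z)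

lemma d_YY: "y \<in> Y \<Longrightarrow> y' \<in> Y \<Longrightarrow> d y y' = (if y = y' then 0 else 2)"
  using nonempty d_refl by (metis all_not_in_conv complete gdist_2 no_edge(2) sym)

lemma d_CY: "c \<in> C \<Longrightarrow> y \<in> Y \<Longrightarrow> d c y = (if E c y then 1 else 2)"
  using C_nbr(2)[of c] complete[of y] gdist_1[of E c y] gdist_2[of c y E] X_ne_Y[OF CX]
  by (metis sym)

text \<open>All neighbours of \<open>a\<close> lie in the stable set \<open>Y\<close>, so
  \<open>a\<close> and \<open>y\<close> have no common neighbour; a path of length 3 goes through a
  neighbour of \<open>a\<close> and any \<open>z\<close>.\<close>

lemma d_AY:
  assumes "a \<in> A" "y \<in> Y" shows "d a y = (if E a y then 1 else 3)"
proof -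
  obtain y' where "y' \<in> Y" "E a y'" using A_nbr assms by blast
  moreover obtain z where "z \<in> Z" using nonempty by auto
  ultimately show ?thesis
    using gdist_1[of E a y] gdist_3[of a y E y' z] complete sym[OF complete, of y z] X_ne_Y[OF AX]
      assms no_edge(2) A_nbrD[OF assms(1)] by (metis (no_types))
qed

lemma d_AZ: "a \<in> A \<Longrightarrow> z \<in> Z \<Longrightarrow> d a z = 2"
  using A_nbr[of a] gdist_2[of a z E] complete[of _ z] X_ne_Z[OF AX, of a z]
  unfolding avoiding_def by blast

lemma d_CC:
  assumes "c \<in> C" "c' \<in> C"
  shows "d c c' = (if c = c' then 0 else if meets E c c' then 2 else 3)"
proof -
  obtain y where "y \<in> Y" "E c y" using C_nbr assms by blast
  moreover obtain z where "z \<in> Z" "E c' z" using C_nbr assms by blast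
  ultimately show ?thesis
    using gdist_2[of c c' E] gdist_3[of c c' E y z] complete[of y z] sym[of c' z] no_edge(1)[OF CX CX] assms d_refl
    unfolding meets_iff by auto
qed

lemma d_AC:
  assumes "c \<in> A" "c' \<in> C" shows "d c c' = (if meets E c c' then 2 else 3)"
proof -
  have "c \<noteq> c'" using assms kinds_disjoint by auto
  obtain y where "y \<in> Y" "E c y" using A_nbr assms by blast
  moreover obtain z where "z \<in> Z" "E c' z" using C_nbr assms by blast
  ultimately show ?thesis
    using gdist_2[of c c' E] gdist_3[of c c' E y z] complete[of y z] sym[of c' z] no_edge(1)[OF AX CX] assms \<open>c \<noteq> c'\<close>
    unfolding meets_iff by auto
qed

text \<open>Length 3 is impossible because it needs an edge between a neighbour of \<open>a\<close>
  and one of \<open>a'\<close>, both in the stable set \<open>Y\<close>; length 4 is reached through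
  any \<open>z\<close>.\<close>

lemma d_AA:
  assumes "a \<in> A" "a' \<in> A"
  shows "d a a' = (if a = a' then 0 else if meets E a a' then 2 else 4)"
proof -
  obtain y where y: "y \<in> Y" "E a y" using A_nbr assms by blast
  obtain y' where y': "y' \<in> Y" "E a' y'" using A_nbr assms by blast
  obtain z where z: "z \<in> Z" using nonempty by auto
  have "\<not> E w a'" if "E a v" "E v w" for v w
    using A_nbrD[OF assms(1)] A_nbrD[OF assms(2)] that no_edge(2) sym by blast
  then show ?thesis
    using gdist_2[of a a' E] gdist_4[of a a' E y z y'] complete[of y z] sym[OF complete, of y' z] sym[of a' y'] no_edge(1)[OF AX AX] assms y y' z d_refl
    unfolding meets_iff by auto
qed

end

context bisplit_space
begin

text \<open>
  Exchanging \<open>Y\<close> and \<open>Z\<close> exchanges \<open>A\<close> and \<open>B\<close> and fixes \<open>C\<close>. The interpretation is repeated in later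
  contexts because it only sees lemmas proved before it.
\<close>

interpretation sw: bisplit_space E X Z Y V
  rewrites "mixed E X Z Y = mixed E X Y Z"
  by (rule swap) (rule mixed_commute)

lemma d_AB:
  assumes "a \<in> A" "b \<in> B" shows "d a b = 3"
proof -
  have "a \<noteq> b" using assms kinds_disjoint by auto
  obtain y where y: "y \<in> Y" "E a y" using A_nbr assms by blast
  obtain z where z: "z \<in> Z" "E b z" using sw.A_nbr assms by blast
  have "\<not> E v b" if "E a v" for v
    using A_nbrD[OF assms(1) that] sw.A_nbrD[OF assms(2), of v] sym disj by blast
  then show ?thesis
    using gdist_3[of a b E y z] complete sym no_edge(1)[OF AX BX] assms y z \<open>a \<noteq> b\<close> by blast
qed

lemmas d_ZY = sw.d_YZ
lemmas d_ZZ = sw.d_YY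
lemmas d_CZ = sw.d_CY
lemmas d_BZ = sw.d_AY
lemmas d_BY = sw.d_AZ
lemmas d_BC = sw.d_AC
lemmas d_BB = sw.d_AA

text \<open>All 25 ordered pairs of kinds are covered, so collinearity of any triple reduces to
  conditions on adjacency and common neighbours.\<close>

lemmas dists = d_YZ d_YY d_CY d_AY d_AZ d_CC d_AC d_AA d_AB d_ZZ d_CZ d_BZ d_BY d_BC d_BB
  d_ZY trans[OF d_commute d_CY] trans[OF d_commute d_AY]
  trans[OF d_commute d_AZ] trans[OF d_commute d_AC] trans[OF d_commute d_AB]
  trans[OF d_commute d_CZ] trans[OF d_commute d_BZ] trans[OF d_commute d_BY] trans[OF d_commute d_BC]

subsection \<open>Traces of the lines\<close>

lemma L_Int: "K \<subseteq> V \<Longrightarrow> L u v \<inter> K = {w \<in> K. w = u \<or> w = v \<or> collinear3 d u v w}"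
  by (auto simp: line_def)

lemma kinds_subset: "Y \<subseteq> V" "Z \<subseteq> V" "A \<subseteq> V" "B \<subseteq> V" "C \<subseteq> V"
  using V_cases by auto

lemmas L_Int_kinds = kinds_subset[THEN L_Int]

lemma kindsD:
  "y \<in> Y \<Longrightarrow> y \<notin> Z \<and> y \<notin> A \<and> y \<notin> B \<and> y \<notin> C"
  "y \<in> Z \<Longrightarrow> y \<notin> Y \<and> y \<notin> A \<and> y \<notin> B \<and> y \<notin> C"
  "y \<in> A \<Longrightarrow> y \<notin> Y \<and> y \<notin> Z \<and> y \<notin> B \<and> y \<notin> C"
  "y \<in> B \<Longrightarrow> y \<notin> Y \<and> y \<notin> Z \<and> y \<notin> A \<and> y \<notin> C"
  "y \<in> C \<Longrightarrow> y \<notin> Y \<and> y \<notin> Z \<and> y \<notin> A \<and> y \<notin> B"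
  using kinds_disjoint by blast+

lemma meets_self: "x \<in> X \<Longrightarrow> meets E x x"
  using has_nbr by (auto simp: meets_def)

lemma meetsI: "E x v \<Longrightarrow> E x' v \<Longrightarrow> meets E x x'"
  by (auto simp: meets_def)

text \<open>This and the following lemmas describe lines by their traces on the kinds; lines are
  later told apart by a single trace. In the exchanged copy \<open>sw\<close> of the lemmas with
  five traces, these are on \<open>Z\<close>, \<open>Y\<close>, \<open>B\<close>, \<open>A\<close>,
  \<open>C\<close> in this order.\<close>

lemma line_YY:
  assumes "y \<in> Y" "y' \<in> Y" "y \<noteq> y'"
  shows "L y y' \<inter> Y = {y, y'}"
    "L y y' \<inter> Z = Z"
    "L y y' \<inter> A = {a \<in> A. E a y \<or> E a y'}"
    "L y y' \<inter> B = {}"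
    "L y y' \<inter> C = {c \<in> C. E c y \<and> E c y'}"
  unfolding L_Int_kinds
  using assms kindsD(1)[OF assms(1)] kindsD(1)[OF assms(2)]
  by (auto simp: collinear3_def between_def dists meets_commute split: if_splits)

lemma line_YZ:
  assumes "y \<in> Y" "z \<in> Z"
  shows "L y z \<inter> Y = Y"
    "L y z \<inter> Z = Z"
    "L y z \<inter> A = A"
    "L y z \<inter> B = B"
    "L y z \<inter> C = {c \<in> C. E c y \<noteq> E c z}"
  unfolding L_Int_kinds
  using assms kindsD(1)[OF assms(1)] kindsD(2)[OF assms(2)]
  by (auto simp: collinear3_def between_def dists meets_commute split: if_splits)

lemma line_AY_edge:
  assumes "a \<in> A" "y \<in> Y" "E a y"
  shows "L a y \<inter> Y = Y"
    "L a y \<inter> Z = Z"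
    "L a y \<inter> A = A"
    "L a y \<inter> B = B"
    "L a y \<inter> C = {c \<in> C. E c y \<or> \<not> meets E a c}"
  unfolding L_Int_kinds
  using assms kindsD(3)[OF assms(1)] kindsD(1)[OF assms(2)]
  by (auto simp: collinear3_def between_def dists meets_commute intro: meetsI split: if_splits)

lemma line_AY_nonedge:
  assumes "a \<in> A" "y \<in> Y" "\<not> E a y"
  shows "L a y \<inter> Y = insert y {y' \<in> Y. E a y'}"
    "L a y \<inter> Z = Z"
    "L a y \<inter> A = insert a {a' \<in> A. E a' y}"
    "L a y \<inter> B = {}"
    "L a y \<inter> C = {c \<in> C. E c y \<and> meets E a c}"
  unfolding L_Int_kinds
  using assms kindsD(3)[OF assms(1)] kindsD(1)[OF assms(2)]
  by (auto simp: collinear3_def between_def dists meets_commute split: if_splits)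

lemma line_AZ:
  assumes "a \<in> A" "z \<in> Z"
  shows "L a z \<inter> Y = Y"
    "L a z \<inter> Z = {z}"
    "L a z \<inter> A = insert a {a' \<in> A. \<not> meets E a a'}"
    "L a z \<inter> B = {b \<in> B. E b z}"
    "L a z \<inter> C = {c \<in> C. E c z \<and> \<not> meets E a c}"
  unfolding L_Int_kinds
  using assms kindsD(3)[OF assms(1)] kindsD(2)[OF assms(2)]
  by (auto simp: collinear3_def between_def dists meets_commute split: if_splits)

lemma line_AC_meets:
  assumes "a \<in> A" "c \<in> C" "meets E a c"
  shows "L a c \<inter> Y = {y \<in> Y. E c y}"
    "L a c \<inter> Z = {}"
    "L a c \<inter> A = insert a {a' \<in> A. meets E a' c \<and> \<not> meets E a a'}"
    "L a c \<inter> B = {}"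
    "L a c \<inter> C = {c}"
  unfolding L_Int_kinds
  using assms kindsD(3)[OF assms(1)] kindsD(5)[OF assms(2)]
  by (auto simp: collinear3_def between_def dists meets_commute split: if_splits)

lemma line_AC_far:
  assumes "a \<in> A" "c \<in> C" "\<not> meets E a c"
  shows "L a c \<inter> Y = {y \<in> Y. E a y}"
    "L a c \<inter> Z = {z \<in> Z. E c z}"
    "L a c \<inter> A = {a}"
    "L a c \<inter> B = {}"
    "L a c \<inter> C = {c}"
  unfolding L_Int_kinds
  using assms kindsD(3)[OF assms(1)] kindsD(5)[OF assms(2)]
  by (auto simp: collinear3_def between_def dists meets_commute intro: meetsI split: if_splits)

lemma line_CC_meets:
  assumes "c \<in> C" "c' \<in> C" "c \<noteq> c'" "meets E c c'"
  shows "L c c' \<inter> Y = {y \<in> Y. E c y \<and> E c' y}"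
    "L c c' \<inter> Z = {z \<in> Z. E c z \<and> E c' z}"
    "L c c' \<inter> A = {}"
    "L c c' \<inter> B = {}"
    "L c c' \<inter> C = {c, c'}"
  unfolding L_Int_kinds
  using assms kindsD(5)[OF assms(1)] kindsD(5)[OF assms(2)]
  by (auto simp: collinear3_def between_def dists meets_commute split: if_splits)

lemma line_CC_far:
  assumes "c \<in> C" "c' \<in> C" "c \<noteq> c'" "\<not> meets E c c'"
  shows "L c c' \<inter> Y = {y \<in> Y. E c y \<or> E c' y}"
    "L c c' \<inter> Z = {z \<in> Z. E c z \<or> E c' z}"
    "L c c' \<inter> A = {}"
    "L c c' \<inter> B = {}"
    "L c c' \<inter> C = {c, c'}"
  unfolding L_Int_kinds
  using assms kindsD(5)[OF assms(1)] kindsD(5)[OF assms(2)]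
  by (auto simp: collinear3_def between_def dists meets_commute intro: meetsI split: if_splits)

lemma line_CY_edge:
  assumes "c \<in> C" "y \<in> Y" "E c y"
  shows "L c y \<inter> Y = {y' \<in> Y. E c y'}"
    "L c y \<inter> Z = {z \<in> Z. \<not> E c z}"
    "L c y \<inter> C = insert c {c' \<in> C. E c' y \<or> \<not> meets E c c'}"
  unfolding L_Int_kinds
  using assms kindsD(5)[OF assms(1)] kindsD(1)[OF assms(2)]
  by (auto simp: collinear3_def between_def dists meets_commute intro: meetsI split: if_splits)

lemma line_CY_nonedge:
  assumes "c \<in> C" "y \<in> Y" "\<not> E c y"
  shows "L c y \<inter> Y = {y}"
    "L c y \<inter> Z = {z \<in> Z. E c z}"
    "L c y \<inter> C = insert c {c' \<in> C. E c' y \<and> \<not> meets E c c'}"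
  unfolding L_Int_kinds
  using assms kindsD(5)[OF assms(1)] kindsD(1)[OF assms(2)]
  by (auto simp: collinear3_def between_def dists meets_commute split: if_splits)

end

section \<open>Families of lines and their sizes\<close>

definition pair_lines :: "'a set \<Rightarrow> ('a \<Rightarrow> 'a \<Rightarrow> nat) \<Rightarrow> 'a set \<Rightarrow> 'a set set" where
  "pair_lines V \<rho> K = {line V \<rho> a b | a b. a \<in> K \<and> b \<in> K \<and> a \<noteq> b}"

text \<open>The three regimes of the count: pairs cover a class of at least 3 vertices, have a
  surplus of 2 from 4 vertices on, and are at most one short in general.\<close>

lemma choose_two_ge: "n \<ge> 3 \<Longrightarrow> n \<le> n choose 2" "n \<ge> 4 \<Longrightarrow> n + 2 \<le> n choose 2"
  "n - 1 \<le> n choose 2"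
proof -
  have 4: "n + 2 \<le> n choose 2" if "n \<ge> 4" for n
    using that by (induction n rule: dec_induct) (auto simp: numeral_eq_Suc)
  have 3: "3 choose 2 = (3::nat)" "2 choose 2 = (1::nat)" "(1::nat) choose 2 = 0"
    by (simp_all add: numeral_eq_Suc)
  show "n + 2 \<le> n choose 2" if "n \<ge> 4" using 4[OF that] .
  show "n \<le> n choose 2" if "n \<ge> 3"
  proof (cases "n = 3")
    case False
    then show ?thesis using 4[of n] that by linarith
  qed (simp add: 3)
  consider "n = 0" | "n = 1" | "n = 2" | "n = 3" | "n \<ge> 4" by linarith
  then show "n - 1 \<le> n choose 2" by cases (use 3 4[of n] in auto)
qed

context bisplit_space
begin

lemma finite_kinds: "finite Y" "finite Z" "finite A" "finite B" "finite C"
  using finV finite_subset kinds_subset by blast+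

lemma in_V: "w \<in> Y \<Longrightarrow> w \<in> V" "w \<in> Z \<Longrightarrow> w \<in> V" "w \<in> A \<Longrightarrow> w \<in> V" "w \<in> B \<Longrightarrow> w \<in> V"
  "w \<in> C \<Longrightarrow> w \<in> V"
  using kinds_subset by blast+

lemma lines_subset: "l \<in> lines V d \<Longrightarrow> l \<subseteq> V"
  by (auto simp: lines_def line_def)

lemma finite_lines: "finite (lines V d)"
proof (rule finite_subset)
  show "lines V d \<subseteq> Pow V" using lines_subset by blast
qed (simp add: finV)

lemma L_in_lines: "u \<in> V \<Longrightarrow> v \<in> V \<Longrightarrow> u \<noteq> v \<Longrightarrow> L u v \<in> lines V d"
  by (auto simp: lines_def)

lemma card_V: "card V = card Y + card Z + card A + card B + card C"
  unfolding V_cases using finite_kinds kinds_disjoint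
  by (simp add: card_Un_disjoint Int_Un_distrib2)

lemma V_eqI:
  assumes "l \<in> lines V d" "l \<inter> Y = Y" "l \<inter> Z = Z" "l \<inter> A = A" "l \<inter> B = B" "l \<inter> C = C"
  shows "l = V"
  using lines_subset[OF assms(1)] assms(2-) V_cases by blast

lemma pair_lines_subset: "K \<subseteq> V \<Longrightarrow> pair_lines V d K \<subseteq> lines V d"
  unfolding pair_lines_def lines_def by blast

text \<open>The trace of such a line on \<open>Y\<close> is its generating pair, so distinct pairs
  give distinct lines.\<close>

lemma card_pair_lines_Y: "card Y choose 2 \<le> card (pair_lines V d Y)"
proof -
  have "{S. S \<subseteq> Y \<and> card S = 2} \<subseteq> (\<lambda>l. l \<inter> Y) ` pair_lines V d Y"
  proof
    fix S assume "S \<in> {S. S \<subseteq> Y \<and> card S = 2}"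
    then obtain y y' where "S = {y, y'}" "y \<in> Y" "y' \<in> Y" "y \<noteq> y'"
      by (auto simp: card_2_iff)
    then show "S \<in> (\<lambda>l. l \<inter> Y) ` pair_lines V d Y"
      using line_YY(1)[of y y'] unfolding pair_lines_def by blast
  qed
  moreover have "finite (pair_lines V d Y)"
    using finite_subset[OF pair_lines_subset[OF kinds_subset(1)] finite_lines] .
  ultimately have "card {S. S \<subseteq> Y \<and> card S = 2} \<le> card (pair_lines V d Y)"
    by (rule surj_card_le[rotated])
  then show ?thesis by (simp add: n_subsets[OF finite_kinds(1)])
qed

text \<open>The line of the edge \<open>ay\<close> misses only vertices \<open>c\<close> of
  \<open>C\<close> that are not adjacent to \<open>y\<close> but share a neighbour with
  \<open>a\<close>. Since it is not universal, such a \<open>c\<close> exists, and the shared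
  neighbour is \<open>y'\<close>.\<close>

lemma AY_edge_obtains:
  assumes "V \<notin> lines V d" "a \<in> A" "y \<in> Y" "E a y"
  obtains c y' where "c \<in> C" "\<not> E c y" "y' \<in> Y" "E a y'" "E c y'" "y' \<noteq> y"
proof -
  have l: "L a y \<in> lines V d"
    using assms kindsD(3)[OF assms(2)] by (intro L_in_lines) (auto simp: in_V)
  have "L a y \<inter> C \<noteq> C"
    using V_eqI[OF l line_AY_edge(1-4)[OF assms(2-4)]] assms(1) l by metis
  then obtain c where c: "c \<in> C" "\<not> E c y" "meets E a c"
    using line_AY_edge(5)[OF assms(2-4)] by auto
  then show thesis
    using that A_nbrD[OF assms(2)] by (auto simp: meets_def)
qed

text \<open>The line \<open>yz\<close> contains everything outside \<open>C\<close>, so not being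
  universal it must miss a vertex of \<open>C\<close>.\<close>

lemma YZ_obtains:
  assumes "V \<notin> lines V d" "y \<in> Y" "z \<in> Z"
  obtains c where "c \<in> C" "E c y = E c z"
proof -
  have l: "L y z \<in> lines V d"
    using assms kindsD(1)[OF assms(2)] by (intro L_in_lines) (auto simp: in_V)
  have "L y z \<inter> C \<noteq> C"
    using V_eqI[OF l line_YZ(1-4)[OF assms(2,3)]] assms(1) l by metis
  then show thesis using that line_YZ(5)[OF assms(2,3)] by auto
qed

lemma C_pair:
  assumes "V \<notin> lines V d" "a \<in> A"
  obtains c c' y where "c \<in> C" "c' \<in> C" "c \<noteq> c'" "y \<in> Y" "\<not> E c y"
proof -
  obtain y where y: "y \<in> Y" "E a y" using A_nbr assms by blast
  obtain c where c: "c \<in> C" "\<not> E c y"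
    using AY_edge_obtains[OF assms y] by blast
  obtain z where "z \<in> Z" "E c z" using C_nbr c by blast
  \<comment> \<open>As \<open>c\<close> is adjacent to \<open>z\<close> but not to \<open>y\<close>,
    it lies on the line \<open>yz\<close>; a vertex missed by that line is therefore different from
    \<open>c\<close>.\<close>
  then show thesis using YZ_obtains[OF assms(1) y(1)] c y that by metis
qed

text \<open>A pendant edge at \<open>a\<close> would generate a universal line, since
  \<open>AY_edge_obtains\<close> supplies a second neighbour.\<close>

lemma A_other_nbr:
  "V \<notin> lines V d \<Longrightarrow> a \<in> A \<Longrightarrow> \<exists>y'\<in>Y. E a y' \<and> y' \<noteq> y"
  using A_nbr[of a] AY_edge_obtains[of a] by metis

lemma card_Y_ge_3:
  assumes "V \<notin> lines V d" "a \<in> A" "\<exists>y\<in>Y. \<not> E a y"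
  shows "3 \<le> card Y"
proof -
  obtain y1 where y1: "y1 \<in> Y" "\<not> E a y1" using assms by auto
  obtain y2 where y2: "y2 \<in> Y" "E a y2" using A_nbr assms by blast
  obtain y3 where y3: "y3 \<in> Y" "E a y3" "y3 \<noteq> y2" using A_other_nbr assms by blast
  have "card {y1, y2, y3} = 3" using y1 y2 y3 by (subst card_3_iff) metis
  moreover have "{y1, y2, y3} \<subseteq> Y" using y1 y2 y3 by auto
  ultimately show ?thesis using card_mono[OF finite_kinds(1)] by metis
qed

text \<open>
  The trace on \<open>A\<close> separates these lines: a line \<open>ay\<close> with \<open>a\<close> not adjacent to \<open>y\<close> adds only \<open>a\<close> to the
  neighbours of \<open>y\<close>, and a line \<open>az\<close> contains no neighbour of \<open>y\<close> in \<open>A\<close> except \<open>a\<close>.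
\<close>

definition A_lines :: "'a \<Rightarrow> 'a \<Rightarrow> 'a set set" where
  "A_lines y z = (\<lambda>a. if E a y then L a z else L a y) ` A"

lemma A_lines_cases:
  assumes "l \<in> A_lines y z"
  obtains a where "a \<in> A" "E a y" "l = L a z" | a where "a \<in> A" "\<not> E a y" "l = L a y"
  using assms unfolding A_lines_def by (auto split: if_splits)

lemma A_lines_subset: "y \<in> Y \<Longrightarrow> z \<in> Z \<Longrightarrow> A_lines y z \<subseteq> lines V d"
proof
  fix l assume yz: "y \<in> Y" "z \<in> Z" and "l \<in> A_lines y z"
  from this(3) obtain a where a: "a \<in> A" "l = L a z \<or> l = L a y"
    by (rule A_lines_cases) auto
  have "a \<noteq> z" "a \<noteq> y" using kindsD(3)[OF a(1)] yz by auto
  moreover have "a \<in> V" "y \<in> V" "z \<in> V" using in_V a yz by blast+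
  ultimately show "l \<in> lines V d" using a(2) L_in_lines by auto
qed

text \<open>Lines of the same type are separated by their traces on \<open>A\<close>. A line
  \<open>az\<close> equals a line \<open>a'y\<close> only if \<open>Z = {z}\<close>, by the traces
  on \<open>Z\<close>, and \<open>a\<close> is the only neighbour of \<open>y\<close> in
  \<open>A\<close>, by the traces on \<open>A\<close>; the last hypothesis excludes this.\<close>

lemma card_A_lines:
  assumes yz: "y \<in> Y" "z \<in> Z" and "Z \<noteq> {z} \<or> card {a \<in> A. E a y} \<noteq> 1"
  shows "card (A_lines y z) = card A"
  unfolding A_lines_def
proof (rule card_image, rule inj_onI)
  have mixed: False if "a \<in> A" "a' \<in> A" "E a y" "\<not> E a' y" "L a z = L a' y" for a a'
  proof -
    have "Z = {z}"
      using line_AZ(2)[of a z] line_AY_nonedge(2)[of a' y] that yz by simp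
    moreover have "insert a {x \<in> A. \<not> meets E a x} = insert a' {x \<in> A. E x y}"
      using line_AZ(3)[of a z] line_AY_nonedge(3)[of a' y] that yz by simp
    then have "{x \<in> A. E x y} = {a}" using that(1,3) meetsI[of a y] by blast
    then have "card {x \<in> A. E x y} = 1" by simp
    ultimately show False using assms(3) by simp
  qed
  fix a a' assume a: "a \<in> A" "a' \<in> A"
    "(if E a y then L a z else L a y) = (if E a' y then L a' z else L a' y)"
  consider "E a y" "E a' y" | "\<not> E a y" "\<not> E a' y" | "E a y" "\<not> E a' y" | "\<not> E a y" "E a' y" by blast
  then show "a = a'"
  proof cases
    case 1
    then have "insert a {x \<in> A. \<not> meets E a x} = insert a' {x \<in> A. \<not> meets E a' x}"
      using line_AZ(3)[of a z] line_AZ(3)[of a' z] a yz by simp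
    then have "a' \<in> insert a {x \<in> A. \<not> meets E a x}" by blast
    then show ?thesis using meetsI[OF 1] by simp
  next
    case 2
    then have "insert a {x \<in> A. E x y} = insert a' {x \<in> A. E x y}"
      using line_AY_nonedge(3)[of a y] line_AY_nonedge(3)[of a' y] a yz by simp
    then show ?thesis using 2 by blast
  qed (use a mixed[of a a'] mixed[of a' a] in auto)
qed

text \<open>In the exceptional case of \<open>card_A_lines\<close>, dropping the single neighbour of
  \<open>y\<close> leaves lines of one type only, and these are distinct.\<close>

lemma card_A_lines_ge:
  assumes yz: "y \<in> Y" "z \<in> Z" shows "card A - 1 \<le> card (A_lines y z)"
proof (cases "card {a \<in> A. E a y} = 1")
  case True
  then obtain a where a: "{a \<in> A. E a y} = {a}" by (auto simp: card_1_singleton_iff)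
  have "inj_on (\<lambda>a. L a y) (A - {a})"
  proof (rule inj_onI)
    fix x x' assume x: "x \<in> A - {a}" "x' \<in> A - {a}" "L x y = L x' y"
    then have E: "\<not> E x y" "\<not> E x' y" using a by auto
    then have "insert x {x \<in> A. E x y} = insert x' {x \<in> A. E x y}"
      using line_AY_nonedge(3)[of x y] line_AY_nonedge(3)[of x' y] x yz by simp
    then show "x = x'" using E by blast
  qed
  then have "card ((\<lambda>a. L a y) ` (A - {a})) = card A - 1"
    using a by (subst card_image) (auto simp: card_Diff_singleton_if)
  moreover have "(\<lambda>a. L a y) ` (A - {a}) \<subseteq> A_lines y z"
    unfolding A_lines_def using a by force
  ultimately show ?thesis
    using card_mono[OF finite_subset[OF A_lines_subset[OF yz] finite_lines]] by metis
qed (simp add: card_A_lines[OF yz])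

definition AC_lines :: "'a \<Rightarrow> 'a set set" where
  "AC_lines a = L a ` C"

lemma AC_lines_subset: "a \<in> A \<Longrightarrow> AC_lines a \<subseteq> lines V d"
proof
  fix l assume a: "a \<in> A" and "l \<in> AC_lines a"
  then obtain c where c: "c \<in> C" "l = L a c" unfolding AC_lines_def by blast
  have "a \<noteq> c" using kindsD(3)[OF a] c by auto
  then show "l \<in> lines V d" using a c L_in_lines[of a c] by (simp add: in_V)
qed

lemma AC_line_trace: "a \<in> A \<Longrightarrow> c \<in> C \<Longrightarrow> L a c \<inter> C = {c}" "a \<in> A \<Longrightarrow> c \<in> C \<Longrightarrow> L a c \<inter> B = {}"
  "a \<in> A \<Longrightarrow> c \<in> C \<Longrightarrow> a \<in> L a c"
  subgoal by (cases "meets E a c"; simp add: line_AC_meets line_AC_far)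
  subgoal by (cases "meets E a c"; simp add: line_AC_meets line_AC_far)
  subgoal by (simp add: line_def)
  done

lemma card_AC_lines:
  assumes "a \<in> A" shows "card (AC_lines a) = card C"
  unfolding AC_lines_def
  by (rule card_image, rule inj_onI) (metis AC_line_trace(1) assms singleton_inject)

lemma CC_line_trace:
  assumes "c \<in> C" "c' \<in> C" "c \<noteq> c'"
  shows "L c c' \<inter> C = {c, c'}" "L c c' \<inter> A = {}" "L c c' \<inter> B = {}"
  by (cases "meets E c c'"; simp add: assms line_CC_meets line_CC_far)+

subsection \<open>The case of a nonempty \<open>A\<close>\<close>

lemma pair_linesE:
  assumes "l \<in> pair_lines V d K"
  obtains u v where "u \<in> K" "v \<in> K" "u \<noteq> v" "l = L u v"
  using assms unfolding pair_lines_def by blast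

text \<open>The set is the trace on \<open>Y\<close> of a line \<open>ay\<close>. If
  \<open>a\<close> were not adjacent to \<open>y\<close>, it would contain \<open>y\<close> and two
  neighbours of \<open>a\<close>, too many for a pair.\<close>

lemma nbrs_not_pair:
  assumes "V \<notin> lines V d" "a \<in> A" shows "insert y {y' \<in> Y. E a y'} = {u, v} \<Longrightarrow> E a y"
proof (rule ccontr)
  assume *: "insert y {y' \<in> Y. E a y'} = {u, v}" "\<not> E a y"
  obtain y1 where y1: "y1 \<in> Y" "E a y1" using A_nbr assms by blast
  obtain y2 where y2: "y2 \<in> Y" "E a y2" "y2 \<noteq> y1" using A_other_nbr assms by blast
  have "{y, y1, y2} \<subseteq> {u, v}" using * y1 y2 by blast
  then have "card {y, y1, y2} \<le> card {u, v}" by (intro card_mono) auto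
  also have "\<dots> \<le> 2" by (simp add: card_insert_if)
  also have "card {y, y1, y2} = 3" using y1 y2 * by (subst card_3_iff) metis
  finally show False by simp
qed

lemma card_3_not_pair: "3 \<le> card K \<Longrightarrow> K \<noteq> {u, v}"
  by (auto simp: card_insert_if split: if_splits)

text \<open>On \<open>Y\<close> the former lines leave a pair, the latter all of \<open>Y\<close> or
  a set that is not a pair by \<open>nbrs_not_pair\<close>.\<close>

lemma pair_lines_Y_A_lines_disjoint:
  assumes nu: "V \<notin> lines V d" and "3 \<le> card Y" "y0 \<in> Y" "z0 \<in> Z"
  shows "pair_lines V d Y \<inter> A_lines y0 z0 = {}"
proof -
  have False if "y \<in> Y" "y' \<in> Y" "y \<noteq> y'" "a \<in> A" "E a y0" "L y y' = L a z0" for y y' a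
    using line_YY(1)[OF that(1-3)] line_AZ(1)[OF that(4) assms(4)] that(6)
      card_3_not_pair[OF assms(2), of y y'] by simp
  moreover have False if "y \<in> Y" "y' \<in> Y" "y \<noteq> y'" "a \<in> A" "\<not> E a y0" "L y y' = L a y0" for y y' a
    using line_YY(1)[OF that(1-3)] line_AY_nonedge(1)[OF that(4) assms(3) that(5)] that(5,6)
      nbrs_not_pair[OF nu that(4), of y0 y y'] by simp
  ultimately show ?thesis by (blast elim!: pair_linesE A_lines_cases)
qed

lemma A_lines_traces:
  assumes "l \<in> A_lines y0 z0" "y0 \<in> Y" "z0 \<in> Z"
  shows "l \<inter> A \<noteq> {}" "l \<inter> Z \<noteq> {}"
  using assms(1)
proof (atomize(full), cases rule: A_lines_cases)
  case (1 a)
  then show "l \<inter> A \<noteq> {} \<and> l \<inter> Z \<noteq> {}"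
    using line_AZ(2,3)[OF 1(1) assms(3)] by auto
next
  case (2 a)
  then show "l \<inter> A \<noteq> {} \<and> l \<inter> Z \<noteq> {}"
    using line_AY_nonedge(2,3)[OF 2(1) assms(2) 2(2)] nonempty by auto
qed

lemma pair_lines_Y_B_trace:
  "l \<in> pair_lines V d Y \<Longrightarrow> l \<inter> B = {}"
  by (metis pair_linesE line_YY(4))

lemma AC_lines_trace: "a \<in> A \<Longrightarrow> l \<in> AC_lines a \<Longrightarrow> l \<inter> B = {}" "a \<in> A \<Longrightarrow> l \<in> AC_lines a \<Longrightarrow> a \<in> l \<inter> A"
  unfolding AC_lines_def using AC_line_trace by blast+

lemma pair_lines_Y_AC_lines_disjoint:
  assumes "a \<in> A"
  shows "pair_lines V d Y \<inter> AC_lines a = {}"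
proof -
  have False if y: "y \<in> Y" "y' \<in> Y" "y \<noteq> y'" and c: "c \<in> C" and eq: "L y y' = L a c" for y y' c
  proof (cases "meets E a c")
    case True
    then show ?thesis
      using line_YY(2)[OF y] line_AC_meets(2)[OF assms c] eq nonempty by simp
  next
    case False
    have "{y'' \<in> Y. E a y''} = {y, y'}"
      using line_YY(1)[OF y] line_AC_far(1)[OF assms c False] eq by simp
    moreover have "{c \<in> C. E c y \<and> E c y'} = {c}"
      using line_YY(5)[OF y] line_AC_far(5)[OF assms c False] eq by simp
    \<comment> \<open>The first equation makes \<open>y\<close> a neighbour of \<open>a\<close>, the
      second makes it a neighbour of \<open>c\<close>.\<close>
    ultimately show False using False meetsI[of a y c] by blast
  qed
  then show ?thesis by (auto elim!: pair_linesE simp: AC_lines_def)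
qed

lemma A_lines_AC_lines_disjoint:
  assumes a: "a \<in> A" "\<exists>y\<in>Y. \<not> E a y" and yz: "y0 \<in> Y" "z0 \<in> Z"
  shows "A_lines y0 z0 \<inter> AC_lines a = {}"
proof -
  have False if c: "c \<in> C" and l: "L a c \<in> A_lines y0 z0" for c
  proof (cases "meets E a c")
    case True
    then show ?thesis
      using A_lines_traces(2)[OF l yz] line_AC_meets(2)[OF a(1) c] by simp
  next
    case False
    note far = line_AC_far[OF a(1) c False]
    from l show False
    proof (cases rule: A_lines_cases)
      case (1 a')
      then show ?thesis using far(1) line_AZ(1)[OF 1(1) yz(2)] a by auto
    next
      case (2 a')
      then have "insert a' {x \<in> A. E x y0} = {a}" "insert y0 {y \<in> Y. E a' y} = {y \<in> Y. E a y}"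
        using far(1,3) line_AY_nonedge(1,3)[OF 2(1) yz(1) 2(2)] by simp_all
      \<comment> \<open>The first equation gives \<open>a' = a\<close>; the second then makes
        \<open>y0\<close> a neighbour of \<open>a'\<close>.\<close>
      then show ?thesis using 2(2) by blast
    qed
  qed
  then show ?thesis by (auto simp: AC_lines_def)
qed

end

context bisplit_space
begin

interpretation sw: bisplit_space E X Z Y V
  rewrites "mixed E X Z Y = mixed E X Y Z"
  by (rule swap) (rule mixed_commute)

lemma pair_lines_YZ_disjoint:
  assumes "3 \<le> card Y" shows "pair_lines V d Y \<inter> pair_lines V d Z = {}"
proof -
  have False if "y \<in> Y" "y' \<in> Y" "y \<noteq> y'" "z \<in> Z" "z' \<in> Z" "z \<noteq> z'" "L y y' = L z z'" for y y' z z'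
    using line_YY(1)[OF that(1-3)] sw.line_YY(2)[OF that(4-6)] that(7)
      card_3_not_pair[OF assms, of y y'] by simp
  then show ?thesis by (auto elim!: pair_linesE)
qed

text \<open>A line \<open>b y1\<close> meets \<open>Y\<close> in \<open>y1\<close> alone and a line
  \<open>b z1\<close> with \<open>b\<close> not adjacent to \<open>z1\<close> misses
  \<open>A\<close>; a line of \<open>A_lines\<close> meets \<open>Y\<close> in more than one vertex
  and also meets \<open>A\<close>.\<close>

lemma A_lines_B_lines_disjoint:
  assumes nu: "V \<notin> lines V d" and "3 \<le> card Y" "y0 \<in> Y" "z0 \<in> Z" "y1 \<in> Y" "z1 \<in> Z"
  shows "A_lines y0 z0 \<inter> sw.A_lines z1 y1 = {}"
proof -
  have False if l: "l \<in> A_lines y0 z0" and l': "l \<in> sw.A_lines z1 y1" for l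
    using l'
  proof (cases rule: sw.A_lines_cases)
    case (1 b)
    then have Y: "l \<inter> Y = {y1}" using sw.line_AZ(2)[OF 1(1) assms(5)] by simp
    from l show False
    proof (cases rule: A_lines_cases)
      case (1 a)
      then have "Y = {y1}" using Y line_AZ(1)[OF 1(1) assms(4)] by simp
      then show False using assms(2) by simp
    next
      case (2 a)
      \<comment> \<open>The singleton is written as a degenerate pair to fit
        \<open>nbrs_not_pair\<close>.\<close>
      then have "insert y0 {y \<in> Y. E a y} = {y1, y1}" using Y line_AY_nonedge(1)[OF 2(1) assms(3) 2(2)] by simp
      then show False using nbrs_not_pair[OF nu 2(1)] 2(2) by blast
    qed
  next
    case (2 b)
    then show False
      using sw.line_AY_nonedge(4)[OF 2(1) assms(6) 2(2)] A_lines_traces(1)[OF l assms(3,4)] by simp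
  qed
  then show ?thesis by blast
qed

lemma sw_A_lines_disjoint:
  assumes "y1 \<in> Y" "z1 \<in> Z"
  shows "pair_lines V d Y \<inter> sw.A_lines z1 y1 = {}" "a \<in> A \<Longrightarrow> AC_lines a \<inter> sw.A_lines z1 y1 = {}"
  using sw.A_lines_traces(1)[of _ z1 y1] pair_lines_Y_B_trace AC_lines_trace(1) assms by blast+

lemma pair_lines_Z_disjoint:
  "a \<in> A \<Longrightarrow> pair_lines V d Z \<inter> AC_lines a = {}"
  "y0 \<in> Y \<Longrightarrow> z0 \<in> Z \<Longrightarrow> pair_lines V d Z \<inter> A_lines y0 z0 = {}"
proof -
  have *: "S \<inter> T = {}" if "\<And>l. l \<in> S \<Longrightarrow> l \<inter> A = {}" "\<And>l. l \<in> T \<Longrightarrow> l \<inter> A \<noteq> {}" for S T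
    using that by blast
  show "pair_lines V d Z \<inter> AC_lines a = {}" if "a \<in> A"
    by (rule *, erule sw.pair_lines_Y_B_trace) (use AC_lines_trace(2)[OF that] in blast)
  show "pair_lines V d Z \<inter> A_lines y0 z0 = {}" if "y0 \<in> Y" "z0 \<in> Z"
    by (rule *, erule sw.pair_lines_Y_B_trace) (rule A_lines_traces(1)[OF _ that])
qed

lemma card_Un_disjoint_lines:
  assumes "S \<union> T \<subseteq> lines V d" "S \<inter> T = {}" shows "card (S \<union> T) = card S + card T"
  using assms finite_subset[OF _ finite_lines] by (intro card_Un_disjoint) auto

lemma card_lines_ge: "S \<subseteq> lines V d \<Longrightarrow> card S \<le> card (lines V d)"
  using card_mono[OF finite_lines] .

text \<open>\<open>maxA\<close> and \<open>maxB\<close> are what maximality of the partition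
  provides: a vertex of \<open>A\<close> joined to all of \<open>Y\<close> could be moved to
  \<open>Z\<close>, and symmetrically. The line families are disjoint, and the cases differ in how a
  shortage of one or two lines is made up.\<close>

lemma card_V_le_if_A_nonempty:
  assumes nu: "V \<notin> lines V d" and "A \<noteq> {}"
    and maxA: "\<And>a. a \<in> A \<Longrightarrow> \<exists>y\<in>Y. \<not> E a y"
    and maxB: "\<And>b. b \<in> B \<Longrightarrow> \<exists>z\<in>Z. \<not> E b z"
  shows "card V \<le> card (lines V d)"
proof -
  obtain a where a: "a \<in> A" using assms(2) by auto
  have p3: "3 \<le> card Y" using card_Y_ge_3[OF nu a maxA[OF a]] .
  obtain z0 where z0: "z0 \<in> Z" using nonempty by auto
  obtain y1 where y1: "y1 \<in> Y" "\<not> E a y1" using maxA a by auto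
  let ?YY = "pair_lines V d Y" and ?ZZ = "pair_lines V d Z" and ?AC = "AC_lines a"
  have base: "?YY \<union> ?ZZ \<union> ?AC \<subseteq> lines V d"
    using pair_lines_subset kinds_subset AC_lines_subset[OF a] by auto
  have cbase: "card (?YY \<union> ?ZZ \<union> ?AC) \<ge> (card Y choose 2) + (card Z choose 2) + card C"
    using card_Un_disjoint_lines[of "?YY \<union> ?ZZ" ?AC] card_Un_disjoint_lines[of "?YY" ?ZZ] base
      pair_lines_YZ_disjoint[OF p3] pair_lines_Y_AC_lines_disjoint[OF a] pair_lines_Z_disjoint(1)[OF a]
      card_pair_lines_Y sw.card_pair_lines_Y card_AC_lines[OF a]
    by (simp add: Int_Un_distrib2)
  have A: "A_lines y0 z0 \<subseteq> lines V d" "(?YY \<union> ?ZZ \<union> ?AC) \<inter> A_lines y0 z0 = {}" if "y0 \<in> Y" for y0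
    using A_lines_subset[OF that z0] pair_lines_Z_disjoint(2)[OF that z0]
      A_lines_AC_lines_disjoint[OF a maxA[OF a] that z0]
      pair_lines_Y_A_lines_disjoint[OF nu p3 that z0] by blast+
  have cA: "card (?YY \<union> ?ZZ \<union> ?AC \<union> A_lines y0 z0) \<ge>
     (card Y choose 2) + (card Z choose 2) + card C + card (A_lines y0 z0)" if "y0 \<in> Y" for y0
    using card_Un_disjoint_lines[OF _ A(2)[OF that]] base A(1)[OF that] cbase by simp
  \<comment> \<open>The common end of all cases: \<open>S\<close> collects the lines special to the
    case, and \<open>y0\<close> is the vertex on which \<open>A_lines\<close> is built.\<close>
  have fin: ?thesis if "?YY \<union> ?ZZ \<union> ?AC \<union> A_lines y0 z0 \<union> S \<subseteq> lines V d" "y0 \<in> Y"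
    "(?YY \<union> ?ZZ \<union> ?AC \<union> A_lines y0 z0) \<inter> S = {}"
    "card V \<le> (card Y choose 2) + (card Z choose 2) + card C + card (A_lines y0 z0) + card S" for S y0
    using card_Un_disjoint_lines[OF that(1,3)] card_lines_ge[OF that(1)] cA[OF that(2)] that(4) by linarith
  show ?thesis
  proof (cases "3 \<le> card Z")
    case True
    \<comment> \<open>With at least 3 vertices in each of \<open>Y\<close> and \<open>Z\<close>,
      pairs cover both classes, and \<open>A_lines\<close> and its mirror image have full
      size.\<close>
    have "Z \<noteq> {z0}" "Y \<noteq> {y1}" using True p3 by auto
    have "sw.A_lines z0 y1 \<subseteq> lines V d" by (rule sw.A_lines_subset[OF z0 y1(1)])
    moreover have "?ZZ \<inter> sw.A_lines z0 y1 = {}"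
      by (rule sw.pair_lines_Y_A_lines_disjoint[OF nu True z0 y1(1)])
    moreover have "card V \<le> (card Y choose 2) + (card Z choose 2) + card C + card (A_lines y1 z0)
        + card (sw.A_lines z0 y1)"
      using card_V card_A_lines[OF y1(1) z0 disjI1] sw.card_A_lines[OF z0 y1(1) disjI1] \<open>Z \<noteq> {z0}\<close> \<open>Y \<noteq> {y1}\<close>
        choose_two_ge(1)[OF True] choose_two_ge(1)[OF p3] by simp
    ultimately show ?thesis
      using base A(1)[OF y1(1)] sw_A_lines_disjoint[OF y1(1) z0] a card_V
        A_lines_B_lines_disjoint[OF nu p3 y1(1) z0 y1(1) z0]
      by (intro fin[of y1 "sw.A_lines z0 y1"]) (simp_all add: Int_Un_distrib2 y1(1))
  next
    case False
    \<comment> \<open>A vertex of \<open>B\<close> would force at least 3 vertices in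
      \<open>Z\<close>, by the mirror image of \<open>card_Y_ge_3\<close>.\<close>
    have B: "B = {}" using sw.card_Y_ge_3[OF nu _ maxB] False by blast
    show ?thesis
    proof (cases "card Y = 3")
      case False
      \<comment> \<open>Here \<open>card Y\<close> is at least 4. The surplus of 2 pays for the line
        possibly missing for \<open>Z\<close> and the one possibly missing in
        \<open>A_lines\<close>; positivity keeps \<open>card A - 1\<close> from being
        truncated.\<close>
      have "card A > 0" using a finite_kinds card_gt_0_iff by blast
      then show ?thesis
        using base A[OF y1(1)] y1(1) card_V B p3 False choose_two_ge(2)[of "card Y"]
          choose_two_ge(3)[of "card Z"] card_A_lines_ge[OF y1(1) z0]
        by (intro fin[of y1 "{}"]) auto
    next
      case p: True
      obtain y2 where y2: "y2 \<in> Y" "E a y2" using A_nbr a by blast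
      obtain y3 where y3: "y3 \<in> Y" "E a y3" "y3 \<noteq> y2" using A_other_nbr[OF nu a] by blast
      have "card {y1, y2, y3} = 3" using y1 y2 y3 by (subst card_3_iff) metis
      then have Y: "Y = {y1, y2, y3}"
        using p y1 y2 y3 finite_kinds by (intro card_subset_eq[symmetric]) auto
      \<comment> \<open>Such a \<open>y0\<close> gives \<open>A_lines\<close> full size. Otherwise
        each vertex of \<open>Y\<close> has exactly one neighbour in \<open>A\<close>; the neighbour
        \<open>a'\<close> of \<open>y1\<close> has a second neighbour, which is \<open>y2\<close> or
        \<open>y3\<close> and so adjacent to \<open>a\<close> too, whence \<open>a' = a\<close>,
        although \<open>a\<close> is not adjacent to \<open>y1\<close>.\<close>
      have "\<exists>y0\<in>Y. card {a \<in> A. E a y0} \<noteq> 1"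
      proof (rule ccontr)
        assume "\<not> ?thesis"
        then have 1: "is_singleton {a \<in> A. E a y}" if "y \<in> Y" for y
          using that by (auto simp: is_singleton_altdef)
        have s: "{a' \<in> A. E a' y} = {a}" if y: "y \<in> Y" "E a y" for y
        proof -
          obtain x where "{a' \<in> A. E a' y} = {x}" using 1[OF y(1)] by (auto simp: is_singleton_def)
          moreover have "a \<in> {a' \<in> A. E a' y}" using a y by simp
          ultimately show ?thesis by simp
        qed
        obtain a' where a': "a' \<in> A" "E a' y1" using 1[OF y1(1)] by (auto simp: is_singleton_def)
        then obtain y' where y': "y' \<in> Y" "E a' y'" "y' \<noteq> y1" using A_other_nbr[OF nu] by blast
        then have "E a y'" using y2 y3 Y by blast
        then have "a' \<in> {a}" using s[OF y'(1)] a' y'(2) by blast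
        then show False using a' y1(2) by simp
      qed
      then obtain y0 where y0: "y0 \<in> Y" "card {a \<in> A. E a y0} \<noteq> 1" by blast
      \<comment> \<open>Pairs in \<open>Z\<close> may be one line short; the line
        \<open>c c'\<close> fills the gap.\<close>
      obtain c c' y where c: "c \<in> C" "c' \<in> C" "c \<noteq> c'" and y: "y \<in> Y" "\<not> E c y"
        using C_pair[OF nu a] by blast
      note tr = CC_line_trace[OF c]
      have "L c c' \<notin> ?YY"
      proof
        assume "L c c' \<in> ?YY"
        then obtain u v where uv: "u \<in> Y" "v \<in> Y" "u \<noteq> v" "L c c' = L u v" by (rule pair_linesE)
        then have "{a \<in> A. E a u \<or> E a v} = {}" using tr(2) line_YY(3)[OF uv(1-3)] by simp
        \<comment> \<open>Two of the three vertices of \<open>Y\<close> always include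
          \<open>y2\<close> or \<open>y3\<close>, neighbours of \<open>a\<close>, so the line
          \<open>uv\<close> would contain \<open>a\<close>.\<close>
        then show False using a uv Y y2 y3 by blast
      qed
      moreover have "L c c' \<notin> ?ZZ"
      proof
        assume "L c c' \<in> ?ZZ"
        then obtain u v where uv: "u \<in> Z" "v \<in> Z" "u \<noteq> v" "L c c' = L u v" by (rule pair_linesE)
        then have "{x \<in> C. E x u \<and> E x v} = {c, c'}" using tr(1) sw.line_YY(5)[OF uv(1-3)] by simp
        \<comment> \<open>Having the common neighbour \<open>u\<close>, the vertices
          \<open>c\<close> and \<open>c'\<close> span a line whose trace on \<open>Y\<close> is
          their common neighbourhood, while the line \<open>uv\<close> contains all of
          \<open>Y\<close>; but \<open>c\<close> is not adjacent to \<open>y\<close>.\<close>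
        then have "meets E c c'" using meetsI by blast
        then have "{y \<in> Y. E c y \<and> E c' y} = Y"
          using uv sw.line_YY(2)[OF uv(1-3)] line_CC_meets(1)[OF c] by simp
        then show False using y by blast
      qed
      moreover have "L c c' \<notin> ?AC"
        using AC_line_trace(1)[OF a] tr(1) c(3) unfolding AC_lines_def by force
      moreover have "L c c' \<notin> A_lines y0 z0"
        using A_lines_traces(1)[OF _ y0(1) z0] tr(2) by blast
      moreover have "L c c' \<in> lines V d" using c by (intro L_in_lines in_V)
      ultimately show ?thesis
        using base A[OF y0(1)] y0(1) card_V B p choose_two_ge(1)[of "card Y"]
          choose_two_ge(3)[of "card Z"] card_A_lines[OF y0(1) z0 disjI2] y0(2)
        by (intro fin[of y0 "{L c c'}"]) auto
    qed
  qed
qed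

subsection \<open>The case of empty \<open>A\<close> and \<open>B\<close>\<close>

definition YZ_lines :: "'a set set" where
  "YZ_lines = {L y z | y z. y \<in> Y \<and> z \<in> Z}"

definition core_lines :: "'a set set" where
  "core_lines = pair_lines V d Y \<union> pair_lines V d Z \<union> YZ_lines"

text \<open>A chosen representative of the twin class of \<open>c\<close>, twins being vertices of
  \<open>C\<close> with the same neighbourhood.\<close>

definition rep :: "'a \<Rightarrow> 'a" where
  "rep c = (SOME x. x \<in> C \<and> E x = E c)"

text \<open>
  The third case only occurs for twin classes of size 2, where the line of the two twins may be
  generated by a pair in \<open>Y\<close> or in \<open>Z\<close>.
\<close>

definition C_line :: "'a \<Rightarrow> 'a set" where
  "C_line c =
    (if c = rep c then L c (SOME y. y \<in> Y \<and> E c y)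
     else if L (rep c) c \<notin> pair_lines V d Y \<union> pair_lines V d Z then L (rep c) c
     else L (rep c) (SOME z. z \<in> Z \<and> E c z))"

lemma core_linesE:
  assumes "l \<in> core_lines"
  obtains (YY) y y' where "y \<in> Y" "y' \<in> Y" "y \<noteq> y'" "l = L y y'"
    | (ZZ) z z' where "z \<in> Z" "z' \<in> Z" "z \<noteq> z'" "l = L z z'"
    | (YZ) y z where "y \<in> Y" "z \<in> Z" "l = L y z"
  using assms unfolding core_lines_def YZ_lines_def pair_lines_def by blast

lemma rep: "c \<in> C \<Longrightarrow> rep c \<in> C" "c \<in> C \<Longrightarrow> E (rep c) = E c"
proof -
  assume "c \<in> C"
  then have "rep c \<in> C \<and> E (rep c) = E c"
    unfolding rep_def by (intro someI[where P = "\<lambda>x. x \<in> C \<and> E x = E c" and x = c]) simp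
  then show "rep c \<in> C" "E (rep c) = E c" by auto
qed

lemma rep_cong: "E c = E c' \<Longrightarrow> rep c = rep c'"
  by (simp add: rep_def)

lemma nbr_eqI:
  assumes "c \<in> C" "c' \<in> C" "\<And>y. y \<in> Y \<Longrightarrow> E c y = E c' y" "\<And>z. z \<in> Z \<Longrightarrow> E c z = E c' z"
  shows "E c = E c'"
proof
  fix w show "E c w = E c' w"
    using X_nbrD[OF CX[OF assms(1)], of w] X_nbrD[OF CX[OF assms(2)], of w] assms(3,4)[of w] by blast
qed

lemma twins_line:
  assumes "c \<in> C" "c' \<in> C" "c \<noteq> c'" "E c = E c'"
  shows "L c c' \<inter> Y = {y \<in> Y. E c y}" "L c c' \<inter> Z = {z \<in> Z. E c z}" "L c c' \<inter> C = {c, c'}"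
proof -
  have "meets E c c'" using meets_self[OF CX[OF assms(1)]] assms(4) by (simp add: meets_def)
  then show "L c c' \<inter> Y = {y \<in> Y. E c y}" "L c c' \<inter> Z = {z \<in> Z. E c z}" "L c c' \<inter> C = {c, c'}"
    using line_CC_meets[OF assms(1-3)] assms(4) by simp_all
qed

text \<open>If the twin line equals a line \<open>y y'\<close>, then \<open>y\<close> and
  \<open>y'\<close> are neighbours of \<open>c\<close> whose only common neighbours in
  \<open>C\<close> are \<open>c\<close> and \<open>c'\<close>, so the twin class is no larger; the
  trace on \<open>Z\<close>, being full, lies in the neighbourhood of \<open>c\<close>.\<close>

lemma twins_line_YY:
  assumes c: "c \<in> C" "c' \<in> C" "c \<noteq> c'" "E c = E c'" and "L c c' \<in> pair_lines V d Y"
  shows "x \<in> C \<Longrightarrow> E x = E c \<Longrightarrow> x \<in> {c, c'}" "z \<in> Z \<Longrightarrow> E c z"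
proof -
  obtain y y' where y: "y \<in> Y" "y' \<in> Y" "y \<noteq> y'" "L c c' = L y y'"
    using assms(5) by (rule pair_linesE)
  have *: "{y \<in> Y. E c y} = {y, y'}" "{z \<in> Z. E c z} = Z" "{c \<in> C. E c y \<and> E c y'} = {c, c'}"
    using twins_line[OF c] line_YY(1,2,5)[OF y(1-3)] y(4) by simp_all
  show "z \<in> Z \<Longrightarrow> E c z" using *(2) by blast
  assume "x \<in> C" "E x = E c"
  moreover have "E c y" "E c y'" using *(1) by blast+
  ultimately have "x \<in> {c \<in> C. E c y \<and> E c y'}" by simp
  then show "x \<in> {c, c'}" unfolding *(3) .
qed

end

section \<open>The lines \<open>C_line c\<close> are new and distinct\<close>

context bisplit_space
begin

interpretation sw: bisplit_space E X Z Y V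
  rewrites "mixed E X Z Y = mixed E X Y Z"
  by (rule swap) (rule mixed_commute)

lemma twins_line_bad:
  assumes c: "c \<in> C" "c' \<in> C" "c \<noteq> c'" "E c = E c'"
    and bad: "L c c' \<in> pair_lines V d Y \<union> pair_lines V d Z"
  shows "x \<in> C \<Longrightarrow> E x = E c \<Longrightarrow> x \<in> {c, c'}" "(\<forall>z\<in>Z. E c z) \<or> (\<forall>y\<in>Y. E c y)"
  using bad twins_line_YY[OF c] sw.twins_line_YY[OF c] by blast+

lemma C_line_cases:
  assumes c: "c \<in> C"
  obtains (edge) y where "y \<in> Y" "E c y" "c = rep c" "C_line c = L c y"
    | (twin) r where "r = rep c" "r \<in> C" "r \<noteq> c" "E r = E c" "C_line c = L r c" "L r c \<notin> pair_lines V d Y \<union> pair_lines V d Z"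
    | (bad) r z where "r = rep c" "r \<in> C" "r \<noteq> c" "E r = E c" "C_line c = L r z" "L r c \<in> pair_lines V d Y \<union> pair_lines V d Z"
      "z \<in> Z" "E r z"
proof -
  have Y: "(SOME y. y \<in> Y \<and> E c y) \<in> Y \<and> E c (SOME y. y \<in> Y \<and> E c y)"
    using C_nbr(1)[OF c] unfolding Bex_def by (rule someI_ex)
  have Z: "(SOME z. z \<in> Z \<and> E c z) \<in> Z \<and> E c (SOME z. z \<in> Z \<and> E c z)"
    using C_nbr(2)[OF c] unfolding Bex_def by (rule someI_ex)
  consider "c = rep c" | "c \<noteq> rep c" "L (rep c) c \<notin> pair_lines V d Y \<union> pair_lines V d Z"
    | "c \<noteq> rep c" "L (rep c) c \<in> pair_lines V d Y \<union> pair_lines V d Z" by blast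
  then show thesis
  proof cases
    case 1
    then have "C_line c = L c (SOME y. y \<in> Y \<and> E c y)" unfolding C_line_def by simp
    then show ?thesis using edge 1 Y by blast
  next
    case 2
    then have "C_line c = L (rep c) c" unfolding C_line_def by simp
    then show ?thesis using twin[of "rep c"] 2 rep[OF c] by metis
  next
    case 3
    then have "C_line c = L (rep c) (SOME z. z \<in> Z \<and> E c z)" unfolding C_line_def by simp
    then show ?thesis using bad[of "rep c"] 3 rep[OF c] Z by metis
  qed
qed

text \<open>The line omits the neighbours of \<open>c\<close> in \<open>Z\<close>, while lines
  generated within \<open>Y\<close> or by \<open>Y\<close> and \<open>Z\<close> contain all of
  \<open>Z\<close>. If it equalled a line \<open>uv\<close> with \<open>u\<close>, \<open>v\<close>
  in \<open>Z\<close>, these would be non-neighbours of \<open>c\<close> by the trace on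
  \<open>Z\<close> and neighbours by the trace on \<open>C\<close>.\<close>

lemma CY_line_not_core:
  assumes c: "c \<in> C" "y \<in> Y" "E c y" shows "L c y \<notin> core_lines"
proof
  obtain z0 where z0: "z0 \<in> Z" "E c z0" using C_nbr(2) c by blast
  have ne: "{z \<in> Z. \<not> E c z} \<noteq> Z" using z0 by blast
  note tr = line_CY_edge[OF c]
  assume "L c y \<in> core_lines"
  then show False
  proof (cases rule: core_linesE)
    case (YY u v)
    then show ?thesis using tr(2) line_YY(2)[OF YY(1-3)] ne by simp
  next
    case (YZ u v)
    then show ?thesis using tr(2) line_YZ(2)[OF YZ(1,2)] ne by simp
  next
    case (ZZ u v)
    then have "{z \<in> Z. \<not> E c z} = {u, v}"
      "insert c {c' \<in> C. E c' y \<or> \<not> meets E c c'} = {x \<in> C. E x u \<and> E x v}"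
      using tr(2,3) sw.line_YY(1,5)[OF ZZ(1-3)] by simp_all
    then show ?thesis by blast
  qed
qed

end

context bisplit_space
begin

interpretation sw: bisplit_space E X Z Y V
  rewrites "mixed E X Z Y = mixed E X Y Z"
  by (rule swap) (rule mixed_commute)

text \<open>Edge lines are covered by \<open>CY_line_not_core\<close> and its mirror image. A twin
  line equal to a line \<open>yz\<close> would make \<open>r\<close> adjacent to all of
  \<open>Y\<close> and \<open>Z\<close>, but on that line \<open>r\<close> is adjacent to exactly
  one of \<open>y\<close> and \<open>z\<close>.\<close>

lemma C_line_not_core:
  assumes c: "c \<in> C" shows "C_line c \<notin> core_lines"
  using c
proof (cases rule: C_line_cases)
  case (edge y)
  then show ?thesis using CY_line_not_core[OF c] by simp
next
  case (twin r)
  note tr = twins_line[OF twin(2) c twin(3,4)]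
  show ?thesis
  proof
    assume "C_line c \<in> core_lines"
    then obtain y z where yz: "y \<in> Y" "z \<in> Z" "L r c = L y z"
      using twin(5,6) unfolding core_lines_def YZ_lines_def by auto
    then have "{y \<in> Y. E r y} = Y" "{z \<in> Z. E r z} = Z" "{r, c} = {x \<in> C. E x y \<noteq> E x z}"
      using tr line_YZ(1,2,5)[OF yz(1,2)] by simp_all
    then show False using yz(1,2) by blast
  qed
next
  case (bad r z)
  have "sw.core_lines = core_lines"
    unfolding core_lines_def sw.core_lines_def YZ_lines_def sw.YZ_lines_def
    using L_commute by (auto; metis)
  then show ?thesis using sw.CY_line_not_core[OF bad(2,7,8)] bad(5) by simp
qed

text \<open>Within one of the three types the traces recover the neighbourhood or the twin pair. An
  edge line never equals a twin line (\<open>ET\<close>, \<open>BT\<close>): the trace on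
  \<open>C\<close> would make the vertices twins, while another trace shows neighbours on one side
  and non-neighbours on the other. For edge lines towards \<open>Y\<close> and \<open>Z\<close>
  (\<open>EB\<close>), equality makes the neighbourhoods complementary, but one of them contains all
  of \<open>Y\<close> or of \<open>Z\<close>.\<close>

lemma C_line_inj: "inj_on C_line C"
proof (rule inj_onI)
  have ET: False if c: "c \<in> C" and y: "y \<in> Y" "E c y" and c': "c' \<in> C" "r' \<in> C" "r' \<noteq> c'" "E r' = E c'"
    and eq: "L c y = L r' c'" for c y c' r'
  proof -
    note tr = line_CY_edge[OF c y] twins_line[OF c'(2,1,3,4)]
    have "c \<in> {r', c'}" using tr(3,6) eq by blast
    then have "E r' = E c" using c' by auto
    moreover have "{z \<in> Z. \<not> E c z} = {z \<in> Z. E r' z}" using tr(2,5) eq by simp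
    ultimately show False using nonempty by auto
  qed
  have BT: False if c: "c \<in> C" and y: "y \<in> Z" "E c y" and c': "c' \<in> C" "r' \<in> C" "r' \<noteq> c'" "E r' = E c'"
    and eq: "L c y = L r' c'" for c y c' r'
  proof -
    note tr = sw.line_CY_edge[OF c y] twins_line[OF c'(2,1,3,4)]
    have "c \<in> {r', c'}" using tr(3,6) eq by blast
    then have "E r' = E c" using c' by auto
    moreover have "{z \<in> Y. \<not> E c z} = {z \<in> Y. E r' z}" using tr(2,4) eq by simp
    ultimately show False using nonempty by auto
  qed
  have EB: False if c: "c \<in> C" and y: "y \<in> Y" "E c y" and r: "r \<in> C" "z \<in> Z" "E r z"
    and bad: "(\<forall>z\<in>Z. E r z) \<or> (\<forall>y\<in>Y. E r y)" and eq: "L c y = L r z" for c y r z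
  proof -
    note tr = line_CY_edge[OF c y] sw.line_CY_edge[OF r]
    have "{z \<in> Z. \<not> E c z} = {z \<in> Z. E r z}" "{y \<in> Y. E c y} = {y \<in> Y. \<not> E r y}"
      using tr(1,2,4,5) eq by simp_all
    then show False using C_nbr[OF c] bad by blast
  qed
  fix c c' assume c: "c \<in> C" and c': "c' \<in> C" and eq: "C_line c = C_line c'"
  show "c = c'"
    using c
  proof (cases rule: C_line_cases)
    case e: (edge y)
    show ?thesis using c'
    proof (cases rule: C_line_cases)
      case (edge y')
      have "{y \<in> Y. E c y} = {y \<in> Y. E c' y}" "{z \<in> Z. \<not> E c z} = {z \<in> Z. \<not> E c' z}"
        using line_CY_edge(1,2)[OF c e(1,2)] line_CY_edge(1,2)[OF c' edge(1,2)] e edge eq by simp_all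
      then have "E c = E c'" by (intro nbr_eqI[OF c c']) blast+
      then show ?thesis using rep_cong e edge by metis
    next
      case (twin r)
      then show ?thesis using ET[OF c e(1,2) c' twin(2-4)] e(4) eq by simp
    next
      case (bad r z)
      then show ?thesis using EB[OF c e(1,2) bad(2,7,8) twins_line_bad(2)[OF bad(2) c' bad(3,4,6)]] e(4) eq by simp
    qed
  next
    case t: (twin r)
    show ?thesis using c'
    proof (cases rule: C_line_cases)
      case (edge y)
      then show ?thesis using ET[OF c' edge(1,2) c t(2-4)] t(5) eq by simp
    next
      case (twin r')
      have rr: "{r, c} = {r', c'}"
        using twins_line(3)[OF t(2) c t(3,4)] twins_line(3)[OF twin(2) c' twin(3,4)] t(5) twin(5) eq by simp
      then have "c = r' \<or> c = c'" by blast
      then have "E c = E c'" using twin(4) by metis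
      then have "rep c = rep c'" by (rule rep_cong)
      then have "r = r'" using t(1) twin(1) by simp
      then show ?thesis using rr by (metis doubleton_eq_iff)
    next
      case (bad r' z)
      then show ?thesis using BT[OF bad(2,7,8) c t(2-4)] t(5) eq by simp
    qed
  next
    case b: (bad r z)
    show ?thesis using c'
    proof (cases rule: C_line_cases)
      case (edge y)
      then show ?thesis using EB[OF c' edge(1,2) b(2,7,8) twins_line_bad(2)[OF b(2) c b(3,4,6)]] b(5) eq by simp
    next
      case (twin r')
      then show ?thesis using BT[OF b(2,7,8) c' twin(2-4)] b(5) eq by simp
    next
      case (bad r' z')
      have "{y \<in> Y. \<not> E r y} = {y \<in> Y. \<not> E r' y}" "{z \<in> Z. E r z} = {z \<in> Z. E r' z}"
        using sw.line_CY_edge(1,2)[OF b(2,7,8)] sw.line_CY_edge(1,2)[OF bad(2,7,8)] b(5) bad(5) eq by simp_all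
      then have "E r = E r'" by (intro nbr_eqI[OF b(2) bad(2)]) blast+
      then have "E c = E c'" using b(4) bad(4) by simp
      then have "rep c = rep c'" by (rule rep_cong)
      then have "r = r'" using b(1) bad(1) by simp
      \<comment> \<open>In this case the twin class consists of \<open>r\<close> and
        \<open>c\<close> alone.\<close>
      moreover have "c' \<in> {r, c}" using twins_line_bad(1)[OF b(2) c b(3,4,6) c'] \<open>E c = E c'\<close> b(4) by simp
      ultimately show ?thesis using bad(3) by blast
    qed
  qed
qed

lemma core_lines_subset: "core_lines \<subseteq> lines V d"
proof
  fix l assume "l \<in> core_lines"
  then show "l \<in> lines V d"
    by (cases rule: core_linesE) (use L_in_lines in_V Y_ne_Z in auto)
qed

lemma C_line_in_lines:
  assumes c: "c \<in> C" shows "C_line c \<in> lines V d"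
  using c
proof (cases rule: C_line_cases)
  case (edge y)
  then show ?thesis using L_in_lines[of c y] in_V c X_ne_Y[OF CX] by metis
next
  case (twin r)
  then show ?thesis using L_in_lines[of r c] in_V c by metis
next
  case (bad r z)
  then show ?thesis using L_in_lines[of r z] in_V c X_ne_Z[OF CX] by metis
qed

text \<open>The frame for the count: \<open>C_line\<close> accounts for \<open>C\<close>, so
  \<open>S\<close> and \<open>T\<close> together only need \<open>card Y + card Z\<close>
  lines.\<close>

lemma card_lines_ge_core:
  assumes "S \<subseteq> core_lines" "T \<subseteq> lines V d" "T \<inter> core_lines = {}" "T \<inter> C_line ` C = {}"
  shows "card S + card T + card C \<le> card (lines V d)"
proof -
  have S: "S \<subseteq> lines V d" using assms(1) core_lines_subset by blast
  have CL: "C_line ` C \<subseteq> lines V d" using C_line_in_lines by blast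
  have d1: "S \<inter> T = {}" using assms by blast
  have d2: "(S \<union> T) \<inter> C_line ` C = {}" using assms(1,4) C_line_not_core by blast
  have "card (S \<union> T \<union> C_line ` C) = card S + card T + card C"
    using card_Un_disjoint_lines[OF _ d1] card_Un_disjoint_lines[OF _ d2] S CL assms(2)
    by (simp add: card_image[OF C_line_inj])
  then show ?thesis using card_lines_ge[of "S \<union> T \<union> C_line ` C"] S CL assms(2) by simp
qed

end

section \<open>Counting the core lines\<close>

context bisplit_space
begin

interpretation sw: bisplit_space E X Z Y V
  rewrites "mixed E X Z Y = mixed E X Y Z"
  by (rule swap) (rule mixed_commute)

lemma core_lines_swap: "sw.core_lines = core_lines"
  unfolding core_lines_def sw.core_lines_def YZ_lines_def sw.YZ_lines_def
  using L_commute by (auto; metis)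

lemma core_linesI:
  "y \<in> Y \<Longrightarrow> y' \<in> Y \<Longrightarrow> y \<noteq> y' \<Longrightarrow> L y y' \<in> core_lines"
  "z \<in> Z \<Longrightarrow> z' \<in> Z \<Longrightarrow> z \<noteq> z' \<Longrightarrow> L z z' \<in> core_lines"
  "y \<in> Y \<Longrightarrow> z \<in> Z \<Longrightarrow> L y z \<in> core_lines"
  unfolding core_lines_def pair_lines_def YZ_lines_def by blast+

lemma finite_core_lines: "finite core_lines"
  using finite_subset[OF core_lines_subset finite_lines] .

text \<open>For a neighbour \<open>y\<close> of \<open>c\<close>, the line \<open>z1 z2\<close>
  cannot equal both \<open>y z1\<close> and \<open>y z2\<close>: testing \<open>c\<close> would make
  it adjacent to both \<open>z1\<close> and \<open>z2\<close> exactly if it is adjacent to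
  neither.\<close>

lemma two_lines_if_card_Z_2:
  assumes "c \<in> C" "z1 \<in> Z" "z2 \<in> Z" "z1 \<noteq> z2"
  shows "\<exists>l\<in>pair_lines V d Z \<union> YZ_lines. \<exists>l'\<in>pair_lines V d Z \<union> YZ_lines. l \<noteq> l'"
proof -
  obtain y where y: "y \<in> Y" "E c y" using C_nbr assms by blast
  note tr = sw.line_YY(5)[OF assms(2-4)] line_YZ(5)[OF y(1) assms(2)] line_YZ(5)[OF y(1) assms(3)]
  have "L z1 z2 \<noteq> L y z1 \<or> L z1 z2 \<noteq> L y z2"
  proof (rule ccontr)
    assume "\<not> ?thesis"
    then have "{c \<in> C. E c z1 \<and> E c z2} = {c \<in> C. E c y \<noteq> E c z1}" "{c \<in> C. E c z1 \<and> E c z2} = {c \<in> C. E c y \<noteq> E c z2}"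
      using tr by simp_all
    then show False using assms(1) y(2) by blast
  qed
  moreover have "L z1 z2 \<in> pair_lines V d Z" "L y z1 \<in> YZ_lines" "L y z2 \<in> YZ_lines"
    using assms y unfolding pair_lines_def YZ_lines_def by blast+
  ultimately show ?thesis by blast
qed

text \<open>Pairs in \<open>Y\<close> already give \<open>card Y\<close> lines, none containing all
  of \<open>Y\<close>. All other core lines do contain \<open>Y\<close>, so it remains to find
  \<open>card Z\<close> among those.\<close>

lemma card_core_lines_if_Y_ge_3:
  assumes "C \<noteq> {}" "3 \<le> card Y"
  shows "card Y + card Z \<le> card core_lines"
proof -
  let ?YY = "pair_lines V d Y" and ?ZZ = "pair_lines V d Z"
  have fin: "finite ?YY" "finite ?ZZ" "finite YZ_lines"
    using finite_core_lines unfolding core_lines_def by auto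
  have Z0: "card Z > 0" using nonempty finite_kinds by (simp add: card_gt_0_iff)
  have YY: "card Y \<le> card ?YY" using card_pair_lines_Y choose_two_ge(1)[OF assms(2)] by linarith
  have d1: "?YY \<inter> ?ZZ = {}" by (rule pair_lines_YZ_disjoint[OF assms(2)])
  have "l \<inter> Y \<noteq> Y" if "l \<in> ?YY" for l
    using that card_3_not_pair[OF assms(2)] line_YY(1) by (metis pair_linesE)
  moreover have "l \<inter> Y = Y" if "l \<in> YZ_lines" for l
    using that line_YZ(1) unfolding YZ_lines_def by blast
  ultimately have d2: "?YY \<inter> YZ_lines = {}" by blast
  have "card Z \<le> card (?ZZ \<union> YZ_lines)"
  proof -
    consider "card Z = 1" | "card Z = 2" | "card Z \<ge> 3" using Z0 by linarith
    then show ?thesis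
    proof cases
      case 1
      obtain y z where "y \<in> Y" "z \<in> Z" using nonempty by auto
      then have "YZ_lines \<noteq> {}" unfolding YZ_lines_def by blast
      then have "card (?ZZ \<union> YZ_lines) > 0" using fin by (simp add: card_gt_0_iff)
      then show ?thesis using 1 by simp
    next
      case 2
      then obtain z1 z2 where "z1 \<in> Z" "z2 \<in> Z" "z1 \<noteq> z2" by (auto simp: card_2_iff)
      moreover obtain c where "c \<in> C" using assms(1) by auto
      ultimately obtain l l' where l: "l \<in> ?ZZ \<union> YZ_lines" "l' \<in> ?ZZ \<union> YZ_lines" "l \<noteq> l'"
        using two_lines_if_card_Z_2 by metis
      then have "card {l, l'} \<le> card (?ZZ \<union> YZ_lines)" using fin by (intro card_mono) auto
      then show ?thesis using 2 l(3) by simp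
    next
      case 3
      then have "card Z \<le> card ?ZZ" using sw.card_pair_lines_Y choose_two_ge(1)[OF 3] by linarith
      also have "\<dots> \<le> card (?ZZ \<union> YZ_lines)" using fin by (intro card_mono) auto
      finally show ?thesis .
    qed
  qed
  moreover have "card core_lines = card ?YY + card (?ZZ \<union> YZ_lines)"
    unfolding core_lines_def Un_assoc using fin d1 d2 by (intro card_Un_disjoint) auto
  ultimately show ?thesis using YY by linarith
qed

lemma YZ_line_misses:
  assumes "V \<notin> lines V d" "y \<in> Y" "z \<in> Z" shows "\<exists>c\<in>C. E c y = E c z"
  using YZ_obtains[OF assms] by blast

text \<open>The line \<open>y1 y2\<close> contains all of \<open>Y\<close> and \<open>Z\<close>, so
  if it is not universal it misses a vertex of \<open>C\<close>.\<close>

lemma YY_line_misses: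
  assumes nu: "V \<notin> lines V d" and AB: "A = {}" "B = {}" and Y: "Y = {y1, y2}" "y1 \<noteq> y2"
  shows "\<exists>c\<in>C. \<not> (E c y1 \<and> E c y2)"
proof (rule ccontr)
  assume *: "\<not> ?thesis"
  have y: "y1 \<in> Y" "y2 \<in> Y" using Y by auto
  note tr = line_YY[OF y Y(2)]
  have l: "L y1 y2 \<in> lines V d" using L_in_lines[OF in_V(1) in_V(1) Y(2)] y by simp
  have "L y1 y2 = V"
    by (rule V_eqI[OF l]) (use tr Y AB * in auto)
  then show False using l nu by simp
qed

end

context bisplit_space
begin

interpretation sw: bisplit_space E X Z Y V
  rewrites "mixed E X Z Y = mixed E X Y Z"
  by (rule swap) (rule mixed_commute)

text \<open>Equality would make every vertex of \<open>C\<close> adjacent to both or neither of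
  \<open>y1\<close>, \<open>y2\<close>, hence to both, against
  \<open>YY_line_misses\<close>.\<close>

lemma YZ_lines_distinct:
  assumes nu: "V \<notin> lines V d" and AB: "A = {}" "B = {}" and Y: "Y = {y1, y2}" "y1 \<noteq> y2" and z: "z \<in> Z"
  shows "L y1 z \<noteq> L y2 z"
proof
  assume "L y1 z = L y2 z"
  then have "{c \<in> C. E c y1 \<noteq> E c z} = {c \<in> C. E c y2 \<noteq> E c z}"
    using line_YZ(5)[of y1 z] line_YZ(5)[of y2 z] Y z by simp
  moreover have "E c y1 \<or> E c y2" if "c \<in> C" for c using C_nbr(1)[OF that] Y by blast
  ultimately show False using YY_line_misses[OF nu AB Y] by blast
qed

lemma card_core_lines_2_1:
  assumes nu: "V \<notin> lines V d" and AB: "A = {}" "B = {}" and Y: "card Y = 2" "card Z = 1"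
  shows "3 \<le> card core_lines"
proof -
  obtain y1 y2 where Y: "Y = {y1, y2}" "y1 \<noteq> y2" using Y(1) by (auto simp: card_2_iff)
  obtain z where Z: "Z = {z}" using assms(5) by (auto simp: card_1_singleton_iff)
  have m: "y1 \<in> Y" "y2 \<in> Y" "z \<in> Z" using Y Z by auto
  have cz: "E c z" if "c \<in> C" for c using C_nbr(2)[OF that] Z by blast
  have cy: "E c y1 \<or> E c y2" if "c \<in> C" for c using C_nbr(1)[OF that] Y by blast
  note tr = line_YY(5)[OF m(1,2) Y(2)] line_YZ(5)[OF m(1,3)] line_YZ(5)[OF m(2,3)]
  \<comment> \<open>As all of \<open>C\<close> is adjacent to \<open>z\<close>, this says that
    \<open>y1\<close> and \<open>y2\<close> each have a neighbour in \<open>C\<close>.\<close>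
  note nus = YZ_line_misses[OF nu m(1,3)] YZ_line_misses[OF nu m(2,3)]
  have "L y1 z \<noteq> L y2 z" by (rule YZ_lines_distinct[OF nu AB Y m(3)])
  moreover have "L y1 y2 \<noteq> L y1 z"
  proof
    assume "L y1 y2 = L y1 z"
    then have "{c \<in> C. E c y1 \<and> E c y2} = {c \<in> C. E c y1 \<noteq> E c z}" using tr by simp
    then show False using nus cz cy by blast
  qed
  moreover have "L y1 y2 \<noteq> L y2 z"
  proof
    assume "L y1 y2 = L y2 z"
    then have "{c \<in> C. E c y1 \<and> E c y2} = {c \<in> C. E c y2 \<noteq> E c z}" using tr by simp
    then show False using nus cz cy by blast
  qed
  ultimately have "card {L y1 y2, L y1 z, L y2 z} = 3" by (subst card_3_iff) metis
  moreover have "{L y1 y2, L y1 z, L y2 z} \<subseteq> core_lines"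
    using core_linesI(1)[OF m(1,2) Y(2)] core_linesI(3) m by blast
  ultimately show ?thesis using card_mono[OF finite_core_lines] by metis
qed

section \<open>Extra lines when \<open>Y\<close> and \<open>Z\<close> both have one or both have two
  vertices\<close>

lemma CZ_line_not_core: "c \<in> C \<Longrightarrow> z \<in> Z \<Longrightarrow> E c z \<Longrightarrow> L c z \<notin> core_lines"
  using sw.CY_line_not_core unfolding core_lines_swap .

text \<open>The obstructions to \<open>cz\<close> being a new line. Equality with an edge line at
  \<open>x\<close> makes the neighbourhoods of \<open>x\<close> and \<open>c\<close> complementary;
  a twin line is impossible; in the third case of \<open>C_line\<close> the representative has the
  neighbourhood of \<open>c\<close>.\<close>

lemma CZ_line_eq_C_line:
  assumes c: "c \<in> C" "z \<in> Z" "E c z" and "x \<in> C" "L c z = C_line x"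
  shows "(\<exists>x\<in>C. (\<forall>y\<in>Y. E x y \<longleftrightarrow> \<not> E c y) \<and> (\<forall>z\<in>Z. E x z \<longleftrightarrow> \<not> E c z))
    \<or> ((\<forall>z\<in>Z. E c z) \<or> (\<forall>y\<in>Y. E c y)) \<and> pair_lines V d Y \<union> pair_lines V d Z \<noteq> {}"
  using assms(4)
proof (cases rule: C_line_cases)
  case (edge y)
  then have "{y \<in> Y. E x y} = {y \<in> Y. \<not> E c y}" "{z \<in> Z. \<not> E x z} = {z \<in> Z. E c z}"
    using sw.line_CY_edge(1,2)[OF c] line_CY_edge(1,2)[OF assms(4) edge(1,2)] assms(5) by simp_all
  then show ?thesis using assms(4) by blast
next
  case (twin r)
  note tr = sw.line_CY_edge(1,2,3)[OF c] twins_line[OF twin(2) assms(4) twin(3,4)]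
  have "c \<in> {r, x}" using tr(3,6) assms(5) twin(5) by blast
  then have "E r = E c" using twin(4) by auto
  moreover have "{y \<in> Y. \<not> E c y} = {y \<in> Y. E r y}" using tr(2,4) assms(5) twin(5) by simp
  ultimately show ?thesis using nonempty by auto
next
  case (bad r z')
  have "{y \<in> Y. \<not> E c y} = {y \<in> Y. \<not> E r y}" "{z \<in> Z. E c z} = {z \<in> Z. E r z}"
    using sw.line_CY_edge(1,2)[OF c] sw.line_CY_edge(1,2)[OF bad(2,7,8)] assms(5) bad(5) by simp_all
  then show ?thesis using twins_line_bad(2)[OF bad(2) assms(4) bad(3,4,6)] bad(6) by blast
qed

lemma card_V_le_1_1:
  assumes "C \<noteq> {}" and AB: "A = {}" "B = {}" and card: "card Y = 1" "card Z = 1"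
  shows "card V \<le> card (lines V d)"
proof -
  obtain y z where YZ: "Y = {y}" "Z = {z}" using card by (auto simp: card_1_singleton_iff)
  obtain c where c: "c \<in> C" using assms(1) by auto
  have all: "E x y" "E x z" if "x \<in> C" for x using C_nbr[OF that] YZ by auto
  have "pair_lines V d Y \<union> pair_lines V d Z = {}" using YZ unfolding pair_lines_def by auto
  \<comment> \<open>All of \<open>C\<close> is adjacent to both \<open>y\<close> and
    \<open>z\<close>, so no complementary neighbourhood exists, and there are no pairs within
    \<open>Y\<close> or \<open>Z\<close>.\<close>
  then have "L c z \<notin> C_line ` C"
    using CZ_line_eq_C_line[OF c _ all(2)[OF c]] all c YZ by blast
  then have "card {L y z} + card {L c z} + card C \<le> card (lines V d)"
    using core_linesI(3)[of y z] CZ_line_not_core[OF c _ all(2)[OF c]] L_in_lines[of c z]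
      in_V(2)[of z] in_V(5)[OF c] X_ne_Z[OF CX[OF c]] YZ
    by (intro card_lines_ge_core) auto
  then show ?thesis using card_V card AB by simp
qed

lemma core_line_Y_trace:
  assumes "l \<in> core_lines" "Y = {y1, y2}" shows "y2 \<in> l"
  using assms(1)
proof (cases rule: core_linesE)
  case (YY u v)
  then show ?thesis using assms(2) by (auto simp: line_def)
next
  case (ZZ u v)
  then show ?thesis using sw.line_YY(2)[OF ZZ(1-3)] assms(2) by blast
next
  case (YZ u v)
  then show ?thesis using line_YZ(1)[OF YZ(1,2)] assms(2) by blast
qed

text \<open>The neighbourhoods of \<open>c\<close> and \<open>c'\<close> are \<open>{y1, z1}\<close>
  and \<open>{y2, z2}\<close>. The line \<open>c' y1\<close> misses \<open>y2\<close>, unlike every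
  core line. It contains \<open>c\<close> and misses \<open>x\<close>: an edge line towards
  \<open>Y\<close> with the same trace on \<open>Y\<close> would contain \<open>x\<close>, and a
  twin line containing \<open>c\<close> would have the wrong trace on \<open>Z\<close>. In the third
  case the representative would be adjacent to neither \<open>y1\<close> nor
  \<open>z1\<close>.\<close>

lemma CY_nonedge_line_new:
  assumes Y: "Y = {y1, y2}" "Z = {z1, z2}"
    and c: "c \<in> C" "\<not> E c y2" "\<not> E c z2" "E c y1"
    and c': "c' \<in> C" "\<not> E c' y1" "\<not> E c' z1"
    and x: "x \<in> C" "E x y1" "E x z2"
    and ne: "y1 \<noteq> y2" "z1 \<noteq> z2"
  shows "L c' y1 \<notin> core_lines" "L c' y1 \<notin> C_line ` C" "L c' y1 \<in> lines V d"
proof -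
  have m: "y1 \<in> Y" "y2 \<in> Y" "z1 \<in> Z" "z2 \<in> Z" using Y by auto
  note tr = line_CY_nonedge[OF c'(1) m(1) c'(2)]
  have z2: "E c' z2" using C_nbr(2)[OF c'(1)] Y c'(3) by blast
  then have Z: "{z \<in> Z. E c' z} = {z2}" using c' Y by blast
  have "\<not> meets E c' c"
    using X_nbrD[OF CX[OF c(1)]] c c' Y by (auto simp: meets_def)
  then have cl: "c \<in> L c' y1" using tr(3) c by blast
  have "x \<notin> insert c' {x \<in> C. E x y1 \<and> \<not> meets E c' x}"
    using x c'(2) meetsI[OF z2 x(3)] by auto
  then have xl: "x \<notin> L c' y1" using tr(3) x(1) by blast
  have "y2 \<notin> L c' y1 \<inter> Y" unfolding tr(1) using ne by simp
  then show "L c' y1 \<notin> core_lines"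
    using core_line_Y_trace[OF _ Y(1)] m(2) by blast
  show "L c' y1 \<in> lines V d"
    using L_in_lines[of c' y1] in_V c' m X_ne_Y[OF CX] by metis
  show "L c' y1 \<notin> C_line ` C"
  proof
    assume "L c' y1 \<in> C_line ` C"
    then obtain u where u: "u \<in> C" "L c' y1 = C_line u" by blast
    from u(1) show False
    proof (cases rule: C_line_cases)
      case (edge y)
      note tr' = line_CY_edge[OF u(1) edge(1,2)]
      have "{y \<in> Y. E u y} = {y1}" using tr(1) tr'(1) u(2) edge(4) by simp
      then have "y = y1" using edge by blast
      then have "x \<in> L u y" using tr'(3) x by blast
      then show False using xl u(2) edge(4) by simp
    next
      case (twin r)
      note tr' = twins_line[OF twin(2) u(1) twin(3,4)]
      have "c \<in> {r, u}" using cl c(1) tr'(3) u(2) twin(5) by blast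
      then have "E r = E c" using twin(4) by auto
      moreover have "{z \<in> Z. E r z} = {z2}" using tr(2) tr'(2) Z u(2) twin(5) by simp
      ultimately show False using c(3) by auto
    next
      case (bad r z)
      note tr' = sw.line_CY_edge[OF bad(2,7,8)]
      have "{y \<in> Y. \<not> E r y} = {y1}" "{z \<in> Z. E r z} = {z2}"
        using tr(1,2) tr'(1,2) u(2) Z bad(5) by simp_all
      then show False using twins_line_bad(2)[OF bad(2) u(1) bad(3,4,6)] m ne by blast
    qed
  qed
qed

lemma new_line:
  assumes nu: "V \<notin> lines V d" and Y: "Y = {y1, y2}" "Z = {z1, z2}" "y1 \<noteq> y2" "z1 \<noteq> z2"
    and H: "\<And>x. x \<in> C \<Longrightarrow> (E x y1 \<noteq> E x y2) = (E x z1 \<noteq> E x z2)"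
    and c: "c \<in> C" "E c y1" "\<not> E c y2" "E c z1" "\<not> E c z2"
  shows "\<exists>l\<in>lines V d. l \<notin> core_lines \<and> l \<notin> C_line ` C"
proof (cases "\<exists>c'\<in>C. \<not> E c' y1 \<and> \<not> E c' z1")
  case True
  then obtain c' where c': "c' \<in> C" "\<not> E c' y1" "\<not> E c' z1" by blast
  then have c'2: "E c' y2" "E c' z2" using C_nbr[OF c'(1)] Y by blast+
  \<comment> \<open>If \<open>x\<close> is adjacent to neither \<open>y1\<close> nor
    \<open>z2\<close>, it is adjacent to \<open>y2\<close> and \<open>z1\<close>; then the indices
    and the roles of \<open>c\<close> and \<open>c'\<close> are exchanged.\<close>
  obtain x where x: "x \<in> C" "E x y1 = E x z2" using YZ_line_misses[OF nu, of y1 z2] Y by blast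
  have x2: "E x y1 \<or> E x y2" "E x z1 \<or> E x z2" using C_nbr[OF x(1)] Y by blast+
  show ?thesis
  proof (cases "E x y1")
    case True
    then show ?thesis using CY_nonedge_line_new[OF Y(1,2) c(1,3,5,2) c' x(1) True _ Y(3,4)] x(2) by blast
  next
    case False
    have Y': "Y = {y2, y1}" "Z = {z2, z1}" using Y by auto
    have "E x y2" "E x z1" using False x x2 by auto
    then show ?thesis
      using CY_nonedge_line_new[OF Y' c' c'2(1) c(1,3,5) x(1)] Y(3,4) by metis
  qed
next
  case False
  have z1: "z1 \<in> Z" using Y by simp
  \<comment> \<open>A vertex with neighbourhood complementary to that of \<open>c\<close> would
    avoid both \<open>y1\<close> and \<open>z1\<close>, so \<open>c z1\<close> itself is
    new.\<close>
  have "\<not> (\<exists>x\<in>C. (\<forall>y\<in>Y. E x y \<longleftrightarrow> \<not> E c y) \<and> (\<forall>z\<in>Z. E x z \<longleftrightarrow> \<not> E c z))"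
    using False c Y by blast
  moreover have "\<not> ((\<forall>z\<in>Z. E c z) \<or> (\<forall>y\<in>Y. E c y))" using c Y by blast
  ultimately have "L c z1 \<notin> C_line ` C" using CZ_line_eq_C_line[OF c(1) z1 c(4)] by blast
  moreover have "L c z1 \<in> lines V d"
    using L_in_lines[of c z1] in_V c z1 X_ne_Z[OF CX] by metis
  ultimately show ?thesis using CZ_line_not_core[OF c(1) z1 c(4)] by blast
qed

end

context bisplit_space
begin

interpretation sw: bisplit_space E X Z Y V
  rewrites "mixed E X Z Y = mixed E X Y Z"
  by (rule swap) (rule mixed_commute)

text \<open>The lines \<open>y1 z1\<close> and \<open>y2 z2\<close> differ, as do
  \<open>y1 z2\<close> and \<open>y2 z1\<close>, as soon as some vertex of \<open>C\<close> has one
  neighbour in one class and two in the other; this gives four lines. Otherwise opposite pairs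
  generate the same line, only three core lines remain, and \<open>new_line\<close> supplies the
  fourth.\<close>

lemma card_V_le_2_2:
  assumes nu: "V \<notin> lines V d" and AB: "A = {}" "B = {}" and card: "card Y = 2" "card Z = 2"
  shows "card V \<le> card (lines V d)"
proof -
  obtain y1 y2 where Y: "Y = {y1, y2}" "y1 \<noteq> y2" using card(1) by (auto simp: card_2_iff)
  obtain z1 z2 where Z: "Z = {z1, z2}" "z1 \<noteq> z2" using card(2) by (auto simp: card_2_iff)
  have m: "y1 \<in> Y" "y2 \<in> Y" "z1 \<in> Z" "z2 \<in> Z" using Y Z by auto
  have V: "card V = 4 + card C" using card_V card AB by simp
  have nbr: "E c y1 \<or> E c y2" "E c z1 \<or> E c z2" if "c \<in> C" for c using C_nbr[OF that] Y Z by blast+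
  note tr = line_YY(5)[OF m(1,2) Y(2)] line_YZ(5)[OF m(1,3)] line_YZ(5)[OF m(1,4)] line_YZ(5)[OF m(2,3)]
    line_YZ(5)[OF m(2,4)]
  have ZY: "L y z1 \<noteq> L y z2" if "y \<in> Y" for y
    using sw.YZ_lines_distinct[OF nu AB(2,1) Z that] L_commute by metis
  have core: "L y1 y2 \<in> core_lines" "L y1 z1 \<in> core_lines" "L y1 z2 \<in> core_lines"
    "L y2 z1 \<in> core_lines" "L y2 z2 \<in> core_lines"
    using core_linesI(1)[OF m(1,2) Y(2)] core_linesI(3) m by blast+
  show ?thesis
  proof (cases "\<forall>x\<in>C. (E x y1 \<noteq> E x y2) = (E x z1 \<noteq> E x z2)")
    case False
    then obtain c where c: "c \<in> C" "(E c y1 \<noteq> E c y2) \<noteq> (E c z1 \<noteq> E c z2)" by blast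
    have "L y1 z1 \<noteq> L y2 z2"
    proof
      assume "L y1 z1 = L y2 z2"
      then have "{c \<in> C. E c y1 \<noteq> E c z1} = {c \<in> C. E c y2 \<noteq> E c z2}" using tr by simp
      then show False using c by blast
    qed
    moreover have "L y1 z2 \<noteq> L y2 z1"
    proof
      assume "L y1 z2 = L y2 z1"
      then have "{c \<in> C. E c y1 \<noteq> E c z2} = {c \<in> C. E c y2 \<noteq> E c z1}" using tr by simp
      then show False using c by blast
    qed
    ultimately have "card {L y1 z1, L y1 z2, L y2 z1, L y2 z2} = 4"
      using ZY[OF m(1)] ZY[OF m(2)] YZ_lines_distinct[OF nu AB Y m(3)] YZ_lines_distinct[OF nu AB Y m(4)]
      by (simp add: card_insert_if)
    then show ?thesis
      using card_lines_ge_core[of "{L y1 z1, L y1 z2, L y2 z1, L y2 z2}" "{}"] core V by simp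
  next
    case True
    then have H: "(E x y1 \<noteq> E x y2) = (E x z1 \<noteq> E x z2)" if "x \<in> C" for x using that by blast
    have "L y1 y2 \<noteq> L y1 z1"
    proof
      assume "L y1 y2 = L y1 z1"
      then have "{c \<in> C. E c y1 \<and> E c y2} = {c \<in> C. E c y1 \<noteq> E c z1}" using tr by simp
      \<comment> \<open>The vertex missed by the line \<open>y1 z2\<close> lies on exactly one of
        the two lines compared.\<close>
      then show False using YZ_line_misses[OF nu m(1,4)] H nbr by blast
    qed
    moreover have "L y1 y2 \<noteq> L y1 z2"
    proof
      assume "L y1 y2 = L y1 z2"
      then have "{c \<in> C. E c y1 \<and> E c y2} = {c \<in> C. E c y1 \<noteq> E c z2}" using tr by simp
      then show False using YZ_line_misses[OF nu m(1,3)] H nbr by blast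
    qed
    ultimately have 3: "card {L y1 y2, L y1 z1, L y1 z2} = 3"
      using ZY[OF m(1)] by (subst card_3_iff) metis
    obtain c where c: "c \<in> C" "\<not> (E c y1 \<and> E c y2)" using YY_line_misses[OF nu AB Y] by blast
    \<comment> \<open>The vertices are relabelled so that \<open>u\<close> and \<open>v\<close> are
      the only neighbours of \<open>c\<close>.\<close>
    obtain u u' where u: "Y = {u, u'}" "u \<noteq> u'" "E c u" "\<not> E c u'"
    proof (cases "E c y1")
      case True
      then show thesis using that[of y1 y2] Y c by blast
    next
      case False
      then have "E c y2" using nbr[OF c(1)] by blast
      moreover have "Y = {y2, y1}" using Y by blast
      ultimately show thesis using that[of y2 y1] False Y(2) by metis
    qed
    obtain v v' where v: "Z = {v, v'}" "v \<noteq> v'" "E c v" "\<not> E c v'"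
    proof (cases "E c z1")
      case True
      then show thesis using that[of z1 z2] Z c H[OF c(1)] nbr[OF c(1)] by blast
    next
      case False
      then have "E c z2" using nbr[OF c(1)] by blast
      moreover have "Z = {z2, z1}" using Z by blast
      ultimately show thesis using that[of z2 z1] False Z(2) by metis
    qed
    have uy: "u = y1 \<and> u' = y2 \<or> u = y2 \<and> u' = y1" using u(1) Y by (metis doubleton_eq_iff)
    have vz: "v = z1 \<and> v' = z2 \<or> v = z2 \<and> v' = z1" using v(1) Z by (metis doubleton_eq_iff)
    have "(E x u \<noteq> E x u') = (E x v \<noteq> E x v')" if "x \<in> C" for x
      using H[OF that] uy vz by blast
    then obtain l where l: "l \<in> lines V d" "l \<notin> core_lines" "l \<notin> C_line ` C"
      using new_line[OF nu u(1) v(1) u(2) v(2) _ c(1) u(3,4) v(3,4)] by blast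
    then show ?thesis
      using card_lines_ge_core[of "{L y1 y2, L y1 z1, L y1 z2}" "{l}"] core V 3 by simp
  qed
qed

lemma card_V_le_if_A_B_empty:
  assumes nu: "V \<notin> lines V d" and AB: "A = {}" "B = {}"
  shows "card V \<le> card (lines V d)"
proof -
  have C: "C \<noteq> {}" using YZ_line_misses[OF nu] nonempty by blast
  have fin: ?thesis if "card Y + card Z \<le> card core_lines"
    using card_lines_ge_core[of core_lines "{}"] that card_V AB by simp
  have pos: "card Y > 0" "card Z > 0" using nonempty finite_kinds by (simp_all add: card_gt_0_iff)
  consider "card Y \<ge> 3" | "card Z \<ge> 3" | "card Y = 1" "card Z = 1" | "card Y = 2" "card Z = 1"
    | "card Y = 1" "card Z = 2" | "card Y = 2" "card Z = 2" using pos by linarith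
  then show ?thesis
  proof cases
    case 1
    then show ?thesis using fin card_core_lines_if_Y_ge_3[OF C] by blast
  next
    case 2
    then show ?thesis using fin sw.card_core_lines_if_Y_ge_3[OF C] core_lines_swap by simp
  next
    case 3
    then show ?thesis by (rule card_V_le_1_1[OF C AB])
  next
    case 4
    then show ?thesis using fin card_core_lines_2_1[OF nu AB 4] by simp
  next
    case 5
    then show ?thesis using fin sw.card_core_lines_2_1[OF nu AB(2,1) 5(2,1)] core_lines_swap by simp
  next
    case 6
    then show ?thesis by (rule card_V_le_2_2[OF nu AB])
  qed
qed

end

context bisplit_space
begin

interpretation sw: bisplit_space E X Z Y V
  rewrites "mixed E X Z Y = mixed E X Y Z"
  by (rule swap) (rule mixed_commute)

lemma has_dBE_property_if_maximal:
  assumes "\<And>a. a \<in> A \<Longrightarrow> \<exists>y\<in>Y. \<not> E a y" "\<And>b. b \<in> B \<Longrightarrow> \<exists>z\<in>Z. \<not> E b z"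
  shows "has_dBE_property V d"
proof (cases "V \<in> lines V d")
  case False
  then have "card V \<le> card (lines V d)"
    using card_V_le_if_A_B_empty card_V_le_if_A_nonempty[OF False _ assms] sw.card_V_le_if_A_nonempty[OF False _ assms(2,1)]
    by blast
  then show ?thesis by (simp add: has_dBE_property_def)
qed (auto simp: has_dBE_property_def)

end

subsection \<open>Bipartite graphs and the choice of the partition\<close>

text \<open>The distances from any vertex to \<open>u\<close> and to \<open>v\<close> differ by at
  most 1, as \<open>uv\<close> is an edge, and have different parity; so they differ by exactly 1,
  which is collinearity.\<close>

lemma bipartite_universal_line:
  assumes sym: "symp E" and V: "V = S \<union> T" "stable E S" "stable E T" "S \<inter> T = {}"
    and EV: "\<And>x y. E x y \<Longrightarrow> x \<in> V \<and> y \<in> V"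
    and conn: "\<And>x y. x \<in> V \<Longrightarrow> y \<in> V \<Longrightarrow> \<exists>k. (E ^^ k) x y"
    and uv: "E u v"
  shows "line V (gdist E) u v = V"
proof -
  have step: "(x \<in> S) \<noteq> (y \<in> S)" if "E x y" for x y
    using that EV[OF that] V unfolding stable_def by blast
  have parity: "(x \<in> S \<longleftrightarrow> y \<in> S) \<longleftrightarrow> even k" if "(E ^^ k) x y" for x y k
    using that
  proof (induction k arbitrary: y)
    case (Suc k)
    then obtain w where "(E ^^ k) x w" "E w y" by auto
    then show ?case using Suc.IH[of w] step[of w y] by auto
  qed simp
  have dist: "(E ^^ gdist E x y) x y" if "x \<in> V" "y \<in> V" for x y
    unfolding gdist_eq_Least using conn[OF that] by (rule LeastI_ex)
  have le: "gdist E x y \<le> k" if "(E ^^ k) x y" for x y k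
    unfolding gdist_eq_Least using that by (rule Least_le)
  have uvV: "u \<in> V" "v \<in> V" "u \<noteq> v" using EV[OF uv] step[OF uv] by auto
  have "collinear3 (gdist E) u v w" if w: "w \<in> V" for w
  proof -
    have "gdist E w v \<le> Suc (gdist E w u)" "gdist E w u \<le> Suc (gdist E w v)"
      using le[OF relpowp_Suc_I[OF dist[OF w uvV(1)] uv]]
        le[OF relpowp_Suc_I[OF dist[OF w uvV(2)] sympD[OF sym uv]]] by simp_all
    moreover have "gdist E w v \<noteq> gdist E w u"
      using parity[OF dist[OF w uvV(1)]] parity[OF dist[OF w uvV(2)]] step[OF uv] by auto
    ultimately have "gdist E w v = gdist E w u + 1 \<or> gdist E w u = gdist E w v + 1" by linarith
    then show ?thesis
      using gdist_1[of E u v] uv uvV(3) gdist_sym[OF sym, of u w] gdist_sym[OF sym, of v w] gdist_sym[OF sym, of u v]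
      unfolding collinear3_def between_def by linarith
  qed
  then show ?thesis using uvV by (auto simp: line_def)
qed

section \<open>Maximal partitions\<close>

definition bisplit_partition :: "'a set \<Rightarrow> ('a \<Rightarrow> 'a \<Rightarrow> bool) \<Rightarrow> 'a set \<Rightarrow> 'a set \<Rightarrow> 'a set \<Rightarrow> bool" where
  "bisplit_partition V E X Y Z \<longleftrightarrow> X \<union> Y \<union> Z = V \<and> X \<inter> Y = {} \<and> X \<inter> Z = {} \<and> Y \<inter> Z = {}
      \<and> stable E X \<and> stable E Y \<and> stable E Z \<and> (\<forall>y\<in>Y. \<forall>z\<in>Z. E y z)"

lemma bisplit_partition_swap:
  "symp E \<Longrightarrow> bisplit_partition V E X Y Z \<Longrightarrow> bisplit_partition V E X Z Y"
  unfolding bisplit_partition_def by (blast dest: sympD)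

text \<open>The exchange that increases \<open>card Y + card Z\<close>: \<open>a\<close> has no
  neighbour in \<open>Z\<close> and is joined to all of \<open>Y\<close>, so it fits into
  \<open>Z\<close>.\<close>

lemma bisplit_partition_move:
  assumes P: "bisplit_partition V E X Y Z" and E: "symp E" "\<And>x. \<not> E x x"
    and a: "a \<in> avoiding E X Z" "\<And>y. y \<in> Y \<Longrightarrow> E a y"
  shows "bisplit_partition V E (X - {a}) Y (insert a Z)"
proof -
  have "a \<in> X" and aZ: "z \<in> Z \<Longrightarrow> \<not> E a z \<and> \<not> E z a" and aY: "y \<in> Y \<Longrightarrow> E y a" for y z
    using a E(1) by (auto simp: avoiding_def dest: sympD)
  have "stable E (X - {a})" "stable E (insert a Z)"
    using P E(2) aZ unfolding bisplit_partition_def stable_def by simp_all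
  then show ?thesis
    using P \<open>a \<in> X\<close> aY unfolding bisplit_partition_def by auto
qed

theorem theorem1:
  fixes V :: "'a set" and E :: "'a \<Rightarrow> 'a \<Rightarrow> bool" and n :: nat
  assumes "n \<ge> 2"
    and "simple_graph V E"
    and "card V = n"
    and "connected_graph V E"
    and "bisplit V E"
  shows "has_dBE_property V (gdist E)"
proof -
  have fin: "finite V" and sym: "symp E" and irr: "\<not> E x x" and EV: "E x y \<Longrightarrow> x \<in> V \<and> y \<in> V" for x y
    using assms(2) unfolding simple_graph_def symp_def by blast+
  have conn: "\<exists>k. (E ^^ k) x y" if xy: "x \<in> V" "y \<in> V" for x y
  proof -
    obtain p where p: "walk_between E x y p"
      using assms(4) xy unfolding connected_graph_def by blast
    then obtain k where "length p = Suc k" by (cases p) (auto simp: walk_between_def)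
    then show ?thesis using p walk_iff_relpowp[of E x y k] by blast
  qed
  have nbr: "\<exists>w. E x w" if x: "x \<in> V" for x
  proof -
    \<comment> \<open>A second vertex exists, and the first step of a walk towards it gives a
      neighbour of \<open>x\<close>.\<close>
    have "V \<noteq> {x}" using assms(1,3) by auto
    then obtain y where y: "y \<in> V" "y \<noteq> x" using x by blast
    obtain k where k: "(E ^^ k) x y" using conn x y by blast
    then obtain j where "k = Suc j" using y(2) by (cases k) auto
    then show ?thesis using k relpowp_Suc_D2 by metis
  qed
  define P where "P = (\<lambda>(X, Y, Z). bisplit_partition V E X Y Z)"
  define m where "m = (\<lambda>(X :: 'a set, Y :: 'a set, Z :: 'a set). card Y + card Z)"
  have P_sub: "X \<subseteq> V" "Y \<subseteq> V" "Z \<subseteq> V" if "P (X, Y, Z)" for X Y Z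
    using that by (auto simp: P_def bisplit_partition_def)
  obtain X0 Y0 Z0 where P0: "P (X0, Y0, Z0)"
    using assms(5) by (auto simp: P_def bisplit_partition_def bisplit_def)
  \<comment> \<open>A strict bound on \<open>card Y + card Z\<close>, so that a partition attaining
    the maximum exists.\<close>
  have "\<forall>t. P t \<longrightarrow> m t < 2 * card V + 1"
  proof (intro allI impI)
    fix t assume "P t"
    then obtain X Y Z where t: "t = (X, Y, Z)" "P (X, Y, Z)" by (cases t) auto
    then have "card Y \<le> card V" "card Z \<le> card V" using P_sub fin card_mono by metis+
    then show "m t < 2 * card V + 1" using t(1) by (simp add: m_def)
  qed
  then obtain t where t: "P t" "\<And>t'. P t' \<Longrightarrow> m t' \<le> m t"
    using ex_has_greatest_nat[of P "(X0, Y0, Z0)" m "2 * card V + 1"] P0 by blast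
  obtain X Y Z where XYZ: "t = (X, Y, Z)" by (cases t) auto
  have P: "bisplit_partition V E X Y Z" using t(1) XYZ by (simp add: P_def)
  have maxi: "card Y' + card Z' \<le> card Y + card Z" if "bisplit_partition V E X' Y' Z'" for X' Y' Z'
    using t(2)[of "(X', Y', Z')"] that XYZ by (simp add: P_def m_def)
  have finYZ: "finite Y" "finite Z" using P fin by (auto simp: bisplit_partition_def)
  show ?thesis
  proof (cases "Y = {} \<or> Z = {}")
    case True
    \<comment> \<open>With one of \<open>Y\<close>, \<open>Z\<close> empty,
      \<open>Y \<union> Z\<close> is stable and the graph is bipartite.\<close>
    then have V: "V = X \<union> (Y \<union> Z)" "stable E X" "stable E (Y \<union> Z)" "X \<inter> (Y \<union> Z) = {}"
      using P by (auto simp: bisplit_partition_def)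
    obtain u where "u \<in> V" using assms(1,3) by fastforce
    then obtain v where uv: "E u v" using nbr by blast
    have "line V (gdist E) u v = V"
      by (rule bipartite_universal_line[OF sym V _ conn uv]) (use EV in auto)
    moreover have "u \<noteq> v" "u \<in> V" "v \<in> V" using irr uv EV by blast+
    ultimately show ?thesis unfolding has_dBE_property_def lines_def by blast
  next
    case False
    interpret bisplit_space E X Y Z V
    proof
      show "\<exists>w\<in>Y \<union> Z. E x w" if x: "x \<in> X" for x
      proof -
        have "x \<in> V" using x P by (auto simp: bisplit_partition_def)
        then obtain w where w: "E x w" using nbr by blast
        have "w \<in> X \<union> Y \<union> Z" using EV[OF w] P by (simp add: bisplit_partition_def)
        moreover have "w \<notin> X" using w x P by (auto simp: bisplit_partition_def stable_def)
        ultimately show ?thesis using w by blast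
      qed
      show "E y x" if "E x y" for x y using sympD[OF sym that] .
      show "x \<in> V" if "E x y" for x y using EV[OF that] by simp
    qed (use P False fin in \<open>simp_all add: bisplit_partition_def Un_assoc\<close>)
    have maxA: "\<exists>y\<in>Y. \<not> E a y" if a: "a \<in> A" for a
    proof (rule ccontr)
      assume "\<not> ?thesis"
      then have "card Y + card (insert a Z) \<le> card Y + card Z"
        using maxi[OF bisplit_partition_move[OF P symp irr a]] by blast
      then show False using kindsD(3)[OF a] finYZ by simp
    qed
    have maxB: "\<exists>z\<in>Z. \<not> E b z" if b: "b \<in> B" for b
    proof (rule ccontr)
      assume "\<not> ?thesis"
      then have "card Z + card (insert b Y) \<le> card Y + card Z"
        using maxi[OF bisplit_partition_move[OF bisplit_partition_swap[OF symp P] symp irr b]] by blast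
      then show False using kindsD(4)[OF b] finYZ by simp
    qed
    show ?thesis by (rule has_dBE_property_if_maximal[OF maxA maxB])
  qed
qed

end
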